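(* Let $X$ be a separable metrizable space that is a union of two disjoint zero-dimensional sets $E$, $F$, where $E$ is absolutely $G_\delta$ and $F$ is absolutely $F_{\sigma\delta}$. Then there is an embedding $h : X \to \mathbb{P}^{\mathbb{N}} \cup \mathbb{Q}^{\mathbb{N}}$ onto a closed subspace of $\mathbb{P}^{\mathbb{N}} \cup \mathbb{Q}^{\mathbb{N}}$ such that $E = h^{-1}(\mathbb{P}^{\mathbb{N}})$ and $F = h^{-1}(\mathbb{Q}^{\mathbb{N}})$.
   Context: All spaces are separable and metrizable; dimension is the usual topological dimension $\dim$, and subsets carry the subspace topology. Let $I = [0,1]$, let $\mathbb{P}$ denote the set of irrational numbers in $[0,1]$ and $\mathbb{Q}$ the set of rational numbers in $[0,1]$ (so $0,1 \in \mathbb{Q}$), and $\mathbb{N} = \{1,2,3,\ldots\}$. The countable products $\mathbb{P}^{\mathbb{N}}$ and $\mathbb{Q}^{\mathbb{N}}$ are regarded as subspaces of the Hilbert cube $I^{\mathbb{N}}$ (product topology), and $\mathbb{P}^{\mathbb{N}} \cup \mathbb{Q}^{\mathbb{N}}$ has the subspace topology from $I^{\mathbb{N}}$. An embedding is a homeomorphism onto its image. A space $Y$ is absolutely $G_\delta$ (absolutely $F_{\sigma\delta}$) if for some, equivalently for any, embedding of $Y$ in a completely metrizable space $Z$, the image of $Y$ is a $G_\delta$-set (respectively an $F_{\sigma\delta}$-set, i.e. a countable intersection of countable unions of closed sets) in $Z$. *)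

theory Defs
  imports "HOL-Analysis.Analysis"
begin

(* The library relation dim_le is the small inductive dimension; on separable metrizable
   spaces it agrees with dim and Ind.  The empty space (dimension -1) counts as
   zero-dimensional here. *)
definition zero_dimensional_space :: "'a topology \<Rightarrow> bool" where
  "zero_dimensional_space X \<longleftrightarrow> X dim_le 0"

definition fsigma_delta_in :: "'a topology \<Rightarrow> 'a set \<Rightarrow> bool" where
  "fsigma_delta_in X = (countable intersection_of fsigma_in X) relative_to topspace X"

(* "For some embedding in some separable completely metrizable space Z".  HOL cannot quantify
   over the carrier type 'z of Z inside a definition, so it is a parameter.  As a hypothesis of
   a theorem with 'z left schematic, this says: for some type 'z and some Z over 'z. *)
definition absolutely_gdelta :: "'z itself \<Rightarrow> 'a topology \<Rightarrow> bool" where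
  "absolutely_gdelta (_ :: 'z itself) Y \<longleftrightarrow>
     (\<exists>(Z :: 'z topology) e. separable_space Z \<and> completely_metrizable_space Z \<and>
        embedding_map Y Z e \<and> gdelta_in Z (e ` topspace Y))"

definition absolutely_fsigma_delta :: "'z itself \<Rightarrow> 'a topology \<Rightarrow> bool" where
  "absolutely_fsigma_delta (_ :: 'z itself) Y \<longleftrightarrow>
     (\<exists>(Z :: 'z topology) e. separable_space Z \<and> completely_metrizable_space Z \<and>
        embedding_map Y Z e \<and> fsigma_delta_in Z (e ` topspace Y))"

(* Coordinates are indexed by nat, i.e. from 0. *)
definition hilbert_cube :: "(nat \<Rightarrow> real) topology" where
  "hilbert_cube = product_topology (\<lambda>_. top_of_set {0..1}) UNIV"

definition irrational_seqs :: "(nat \<Rightarrow> real) set" where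
  "irrational_seqs = (\<Pi>\<^sub>E n\<in>UNIV. {0..1} - \<rat>)"

definition rational_seqs :: "(nat \<Rightarrow> real) set" where
  "rational_seqs = (\<Pi>\<^sub>E n\<in>UNIV. {0..1} \<inter> \<rat>)"

definition PQ_space :: "(nat \<Rightarrow> real) topology" where
  "PQ_space = subtopology hilbert_cube (irrational_seqs \<union> rational_seqs)"

end

(* The main tool is a function g : X -> [0,1], defined whenever A is closed in X and X - A splits
   into a zero-dimensional G_delta set E and a zero-dimensional rest, that vanishes exactly on A,
   is irrational on E and rational off E.  Write X - E as a union of closed sets C_n and enumerate
   the rationals as r_n; g is the limit of functions g_n with a shrinking modulus of change.  At
   stage n, zero-dimensionality of E lets g_n be moved off the value r_n on E, and
   zero-dimensionality of C_n - A lets it be made rational on C_n, where it is then frozen.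

   Using the zero sets of suitable partitions as A, countably many such functions embed X into
   Y = P^N + Q^N with E going to P^N and F to Q^N.  The images of E and F are again G_delta and
   F_sigma_delta.  The image of X is not yet closed in Y: for each closed piece C of Y - E add a
   coordinate that vanishes on C and is irrational on E, and for each G_delta piece G of Y - F and
   each rational q add a coordinate that is irrational on P^N and on the points y of Q^N with
   y in G and y_0 = q, and rational elsewhere.  After this only the points of X keep all their
   coordinates of one kind. *)
theory Submission
  imports Defs
begin

subsection \<open>Zero-dimensional subsets of separable metric spaces\<close>

text \<open>Every point has a clopen neighbourhood inside some member of the cover, and countably
  many of these suffice by Lindelof. Sending a point to the first one that contains it makes the
  choice locally constant, which is why preimages of arbitrary sets \<open>J\<close> are
  open.\<close>

lemma zero_dimensional_selection:
  fixes Y :: "'a::second_countable_topology set"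
  assumes zd: "zero_dimensional_space (top_of_set Y)"
    and op: "\<And>i. i \<in> I \<Longrightarrow> openin (top_of_set Y) (U i)"
    and cov: "Y \<subseteq> (\<Union>i\<in>I. U i)"
  shows "\<exists>s. (\<forall>x\<in>Y. s x \<in> I \<and> x \<in> U (s x)) \<and> (\<forall>J. openin (top_of_set Y) {x \<in> Y. s x \<in> J})"
proof (cases "Y = {}")
  case True
  then show ?thesis by auto
next
  case False
  define \<W> where "\<W> = {W. closedin (top_of_set Y) W \<and> openin (top_of_set Y) W \<and> (\<exists>i\<in>I. W \<subseteq> U i)}"
  have "neighbourhood_base_of (\<lambda>W. closedin (top_of_set Y) W \<and> openin (top_of_set Y) W) (top_of_set Y)"
    using zd dimension_le_0_neighbourhood_base_of_clopen unfolding zero_dimensional_space_def by blast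
  then have nb: "\<exists>W. (closedin (top_of_set Y) W \<and> openin (top_of_set Y) W) \<and> x \<in> W \<and> W \<subseteq> V"
    if "openin (top_of_set Y) V" "x \<in> V" for V x
    using that by (subst (asm) open_neighbourhood_base_of) auto
  have "Y \<subseteq> \<Union>\<W>"
  proof
    fix x assume "x \<in> Y"
    then obtain i where i: "i \<in> I" "x \<in> U i" using cov by auto
    then obtain W where "closedin (top_of_set Y) W" "openin (top_of_set Y) W" "x \<in> W" "W \<subseteq> U i"
      using nb[OF op] by metis
    then show "x \<in> \<Union>\<W>" using i unfolding \<W>_def by auto
  qed
  moreover obtain \<W>' where W': "\<W>' \<subseteq> \<W>" "countable \<W>'" "\<Union>\<W>' = \<Union>\<W>"
    using Lindelof_openin[of \<W> Y] unfolding \<W>_def by (metis (no_types, lifting) mem_Collect_eq)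
  ultimately have covW: "Y \<subseteq> \<Union>\<W>'" by auto
  then have ne: "\<W>' \<noteq> {}" using False by auto
  define w where "w = from_nat_into \<W>'"
  have rw: "range w = \<W>'" unfolding w_def using ne W' by (simp add: range_from_nat_into)
  then have w: "closedin (top_of_set Y) (w n)" "openin (top_of_set Y) (w n)" "\<exists>i\<in>I. w n \<subseteq> U i" for n
    using W' unfolding \<W>_def by blast+
  have ex: "\<exists>n. x \<in> w n" if "x \<in> Y" for x using that covW rw by auto
  from w(3) obtain i where i: "\<And>n. i n \<in> I \<and> w n \<subseteq> U (i n)" by metis
  define n where "n x = (LEAST n. x \<in> w n)" for x
  have n: "x \<in> w (n x)" if "x \<in> Y" for x unfolding n_def using ex[OF that] by (rule LeastI_ex)
  have n2: "n x = m \<longleftrightarrow> x \<in> w m \<and> (\<forall>k<m. x \<notin> w k)" if "x \<in> Y" for x m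
    using ex[OF that] unfolding n_def
    by (metis (mono_tags, lifting) LeastI_ex Least_equality linorder_not_less not_less_Least)
  show ?thesis
  proof (intro exI conjI ballI allI)
    show "i (n x) \<in> I" "x \<in> U (i (n x))" if "x \<in> Y" for x using n[OF that] i by auto
    fix J
    \<comment> \<open>A fibre of \<open>n\<close> is one member of the sequence minus finitely many
      earlier ones. These are also closed, so the fibre is open.\<close>
    have "{x \<in> Y. i (n x) \<in> J} = (\<Union>m\<in>{m. i m \<in> J}. w m - (\<Union>k\<in>{..<m}. w k))"
    proof (intro set_eqI iffI)
      fix x assume "x \<in> {x \<in> Y. i (n x) \<in> J}"
      then show "x \<in> (\<Union>m\<in>{m. i m \<in> J}. w m - (\<Union>k\<in>{..<m}. w k))"
        using n2[of x "n x"] by auto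
    next
      fix x assume "x \<in> (\<Union>m\<in>{m. i m \<in> J}. w m - (\<Union>k\<in>{..<m}. w k))"
      then obtain m where m: "i m \<in> J" "x \<in> w m" "\<forall>k<m. x \<notin> w k" by auto
      then have "x \<in> Y" using openin_imp_subset[OF w(2)] by blast
      then show "x \<in> {x \<in> Y. i (n x) \<in> J}" using n2[of x m] m by auto
    qed
    moreover have "openin (top_of_set Y) (w m - (\<Union>k\<in>{..<m}. w k))" for m
      by (rule openin_diff[OF w(2)]) (auto intro!: closedin_Union w(1))
    ultimately show "openin (top_of_set Y) {x \<in> Y. i (n x) \<in> J}" by auto
  qed
qed

lemma zero_dimensional_space_clopenI:
  fixes Y :: "'a::topological_space set"
  assumes "\<And>x V. openin (top_of_set Y) V \<Longrightarrow> x \<in> V \<Longrightarrow>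
     \<exists>U. openin (top_of_set Y) U \<and> openin (top_of_set Y) (Y - U) \<and> x \<in> U \<and> U \<subseteq> V"
  shows "zero_dimensional_space (top_of_set Y)"
  unfolding zero_dimensional_space_def dimension_le_0_neighbourhood_base_of_clopen
proof (subst open_neighbourhood_base_of, simp, intro allI impI, elim conjE)
  fix V x assume "openin (top_of_set Y) V" "x \<in> V"
  from assms[OF this] show "\<exists>U. (closedin (top_of_set Y) U \<and> openin (top_of_set Y) U) \<and> x \<in> U \<and> U \<subseteq> V"
    by (metis closedin_def openin_subset topspace_euclidean_subtopology)
qed

lemma zero_dimensional_space_subset:
  "zero_dimensional_space (subtopology X T) \<Longrightarrow> S \<subseteq> T \<Longrightarrow> zero_dimensional_space (subtopology X S)"
  unfolding zero_dimensional_space_def by (rule dimension_le_subtopologies)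

text \<open>The two-set case of the selection, with \<open>bool\<close> as index set.\<close>

lemma zero_dimensional_clopen_partition:
  fixes E :: "'a::second_countable_topology set"
  assumes zd: "zero_dimensional_space (top_of_set E)"
    and "openin (top_of_set E) U" "openin (top_of_set E) V" "E \<subseteq> U \<union> V"
  obtains E1 E2 where "openin (top_of_set E) E1" "openin (top_of_set E) E2"
    "E1 \<union> E2 = E" "E1 \<inter> E2 = {}" "E1 \<subseteq> U" "E2 \<subseteq> V"
proof -
  have "\<And>b. openin (top_of_set E) (if b then U else V)" "E \<subseteq> (\<Union>b\<in>UNIV. if b then U else V)"
    using assms by (auto simp: UNIV_bool)
  then obtain s where s: "\<And>x. x \<in> E \<Longrightarrow> s x \<in> (UNIV::bool set) \<and> x \<in> (if s x then U else V)"
    and op: "\<And>J. openin (top_of_set E) {x \<in> E. s x \<in> J}"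
    using zero_dimensional_selection[OF zd, of UNIV "\<lambda>b. if b then U else V"] by metis
  have "openin (top_of_set E) {x \<in> E. s x}" "openin (top_of_set E) {x \<in> E. \<not> s x}"
    using op[of "{True}"] op[of "{False}"] by auto
  moreover have "{x \<in> E. s x} \<subseteq> U" "{x \<in> E. \<not> s x} \<subseteq> V" using s by fastforce+
  ultimately show ?thesis by (intro that[of "{x \<in> E. s x}" "{x \<in> E. \<not> s x}"]) auto
qed

text \<open>A special case of the sum theorem. First \<open>G\<close> is cut into two clopen pieces,
  then normality enlarges them to open sets with disjoint closures, and finally the open remainder
  \<open>E - G\<close> is distributed between the two sides.\<close>

lemma zero_dimensional_Un_closed:
  fixes E G :: "'a::{metric_space,second_countable_topology} set"
  assumes zE: "zero_dimensional_space (top_of_set E)"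
    and zG: "zero_dimensional_space (top_of_set G)"
    and clG: "closedin (top_of_set (E \<union> G)) G"
  shows "zero_dimensional_space (top_of_set (E \<union> G))"
proof (rule zero_dimensional_space_clopenI)
  define Y where "Y = E \<union> G"
  have zEG: "zero_dimensional_space (top_of_set (E - G))" using zE zero_dimensional_space_subset by blast
  have opE: "openin (top_of_set Y) (E - G)"
    using clG unfolding Y_def by (metis Un_Diff Un_empty_right Diff_cancel openin_diff openin_subtopology_self)
  fix x V assume V: "openin (top_of_set (E \<union> G)) V" "x \<in> V"
  \<comment> \<open>Whether or not \<open>x\<close> lies in \<open>G\<close>, partitioning
    \<open>G\<close> along \<open>V\<close> and the complement of \<open>x\<close> keeps
    \<open>G1\<close> inside \<open>V\<close> and \<open>x\<close> out of \<open>G2\<close>.\<close>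
  have "\<exists>G1 G2. openin (top_of_set G) G1 \<and> openin (top_of_set G) G2 \<and> G1 \<union> G2 = G \<and> G1 \<inter> G2 = {}
    \<and> x \<notin> G2 \<and> G1 \<subseteq> V"
  proof -
    have "openin (top_of_set G) (V \<inter> G)"
      using V(1) by (metis Un_upper2 inf.commute openin_subtopology_Int2 subtopology_subtopology inf.absorb_iff2)
    moreover have "openin (top_of_set G) (G - {x})"
      by (simp add: openin_delete)
    moreover have "G \<subseteq> V \<inter> G \<union> (G - {x})" using V by auto
    ultimately show ?thesis using zero_dimensional_clopen_partition[OF zG] by (smt (verit, best) DiffD2 insertI1 le_inf_iff subsetD)
  qed
  then obtain G1 G2 where G: "openin (top_of_set G) G1" "openin (top_of_set G) G2" "G1 \<union> G2 = G"
      "G1 \<inter> G2 = {}" "x \<notin> G2" "G1 \<subseteq> V" by blast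
  have cl: "closedin (top_of_set Y) G1" "closedin (top_of_set Y) G2"
  proof -
    have "G1 = G - G2" "G2 = G - G1" using G by auto
    then have "closedin (top_of_set G) G1" "closedin (top_of_set G) G2"
      using G(1,2) by (metis closedin_diff closedin_subtopology_refl subset_UNIV topspace_euclidean)+
    then show "closedin (top_of_set Y) G1" "closedin (top_of_set Y) G2"
      using clG closedin_trans unfolding Y_def by blast+
  qed
  \<comment> \<open>The desired clopen set must contain \<open>P\<close> and miss \<open>Q\<close>.
    The point \<open>x\<close> is added because it may lie outside \<open>G\<close>, and the
    complement of \<open>V\<close> because the result has to stay inside \<open>V\<close>.\<close>
  define P where "P = insert x G1"
  define Q where "Q = (Y - V) \<union> G2"
  have clP: "closedin (top_of_set Y) P" unfolding P_def
    by (metis cl(1) V Y_def closedin_Un closedin_singleton insert_is_Un openin_subset subsetD topspace_euclidean_subtopology)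
  have clQ: "closedin (top_of_set Y) Q" unfolding Q_def Y_def
    using V cl Y_def by (metis closedin_Un closedin_diff closedin_subtopology_refl subset_UNIV topspace_euclidean)
  have disj: "P \<inter> Q = {}" using G V unfolding P_def Q_def by auto
  have "normal_space (top_of_set Y)"
    using metrizable_imp_normal_space metrizable_space_euclidean metrizable_space_subtopology by blast
  then obtain U1 U2 where U: "openin (top_of_set Y) U1" "openin (top_of_set Y) U2" "P \<subseteq> U1" "Q \<subseteq> U2"
     "disjnt (top_of_set Y closure_of U1) (top_of_set Y closure_of U2)"
    using clP clQ disj by (metis disjnt_def normal_space_disjoint_closures)
  define K1 where "K1 = top_of_set Y closure_of U1"
  define K2 where "K2 = top_of_set Y closure_of U2"
  have K: "closedin (top_of_set Y) K1" "closedin (top_of_set Y) K2" "U1 \<subseteq> K1" "U2 \<subseteq> K2" "K1 \<inter> K2 = {}"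
    using U unfolding K1_def K2_def disjnt_def 
    by (auto dest: openin_subset intro!: closure_of_subset)
  \<comment> \<open>Keeping \<open>E1\<close> off \<open>K2\<close> and \<open>E2\<close> off
    \<open>K1\<close> makes \<open>U1 \<union> E1\<close> and \<open>U2 \<union> E2\<close>
    disjoint. They cover \<open>Y\<close> because \<open>G\<close> lies in
    \<open>P \<union> Q\<close>.\<close>
  have opEU: "openin (top_of_set (E - G)) ((E - G) - K2)" "openin (top_of_set (E - G)) ((E - G) - K1)"
    using K(1,2) opE
    by (metis Diff_subset openin_diff openin_subset_trans openin_imp_subset)+
  obtain E1 E2 where E: "openin (top_of_set (E - G)) E1" "openin (top_of_set (E - G)) E2"
    "E1 \<union> E2 = E - G" "E1 \<inter> E2 = {}" "E1 \<subseteq> (E - G) - K2" "E2 \<subseteq> (E - G) - K1"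
    using zero_dimensional_clopen_partition[OF zEG opEU] K(5) by auto
  have opEi: "openin (top_of_set Y) E1" "openin (top_of_set Y) E2"
    using E(1,2) opE openin_trans by blast+
  let ?U = "U1 \<union> E1"
  have co: "Y - ?U = U2 \<union> E2"
  proof
    show "Y - ?U \<subseteq> U2 \<union> E2"
      using E(3) G(3) U(3,4) unfolding P_def Q_def Y_def by auto
    have "U2 \<subseteq> Y" "E2 \<subseteq> Y" using U(2) opEi openin_imp_subset by auto
    then show "U2 \<union> E2 \<subseteq> Y - ?U"
      using K E by blast
  qed
  have "?U \<subseteq> Y" using U(1) opEi openin_imp_subset by auto
  then have "?U \<subseteq> V" using co U(4) unfolding Q_def by auto
  then show "\<exists>U. openin (top_of_set (E \<union> G)) U \<and> openin (top_of_set (E \<union> G)) (E \<union> G - U) \<and> x \<in> U \<and> U \<subseteq> V"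
    using U opEi co unfolding Y_def P_def by (intro exI[of _ ?U]) auto
qed

subsection \<open>Functions that are irrational on one set and rational on another\<close>

text \<open>The difference of the distances to the two sets has the right signs, since a point of
  one set is outside the closure of the other. Empty sets are treated apart because
  \<open>infdist\<close> to the empty set is 0 by convention.\<close>

lemma separated_sets_function:
  fixes A B :: "'a::metric_space set"
  assumes "A \<inter> closure B = {}" "closure A \<inter> B = {}"
  obtains f :: "'a \<Rightarrow> real" where "continuous_on UNIV f"
    "\<And>x. x \<in> A \<Longrightarrow> f x < 0" "\<And>x. x \<in> B \<Longrightarrow> 0 < f x"
proof -
  consider "A = {}" | "B = {}" | "A \<noteq> {}" "B \<noteq> {}" by blast
  then show ?thesis
  proof cases
    case 1 then show ?thesis using that[of "\<lambda>_. 1"] by auto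
  next
    case 2 then show ?thesis using that[of "\<lambda>_. -1"] by auto
  next
    case 3
    have pos: "0 < infdist x C" if "C \<noteq> {}" "x \<notin> closure C" for x :: 'a and C
      using that in_closure_iff_infdist_zero[of C x] infdist_nonneg[of x C] by linarith
    show ?thesis
      by (rule that[of "\<lambda>x. infdist x A - infdist x B"])
         (use 3 pos assms in \<open>auto intro!: continuous_intros\<close>)
  qed
qed

lemma closedin_zero_set:
  fixes A X :: "'a::metric_space set"
  assumes "closedin (top_of_set X) A"
  obtains a :: "'a \<Rightarrow> real" where "continuous_on X a" "\<And>x. 0 \<le> a x \<and> a x \<le> 1"
    "\<And>x. x \<in> X \<Longrightarrow> a x = 0 \<longleftrightarrow> x \<in> A"
proof (cases "A = {}")
  case True
  then show ?thesis using that[of "\<lambda>_. 1"] by auto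
next
  case False
  obtain K where K: "closed K" "A = X \<inter> K" using assms by (auto simp: closedin_closed)
  show ?thesis
  proof
    show "continuous_on X (\<lambda>x. min 1 (infdist x A))" by (intro continuous_intros)
    show "0 \<le> min 1 (infdist x A) \<and> min 1 (infdist x A) \<le> 1" for x by (auto simp: infdist_nonneg)
    fix x assume "x \<in> X"
    then have "x \<in> A" if "x \<in> closure A" using K that by (metis Int_iff Int_lower2 closure_minimal subsetD)
    then show "min 1 (infdist x A) = 0 \<longleftrightarrow> x \<in> A"
      using False in_closure_iff_infdist_zero[of A x] closure_subset[of A] by (auto simp: min_def)
  qed
qed

text \<open>Nothing is assumed about \<open>h\<close> at the zeros of \<open>\<eta>\<close>: there
  the bound squeezes the glued function onto \<open>f\<close>. This permits corrections whose
  construction divides by \<open>\<eta>\<close>.\<close>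

lemma continuous_on_replace_within:
  fixes f h \<eta> :: "'a::metric_space \<Rightarrow> real"
  assumes f: "continuous_on X f" and \<eta>: "continuous_on X \<eta>"
    and h: "continuous_on {x\<in>X. 0 < \<eta> x} h"
    and le: "\<And>x. x \<in> X \<Longrightarrow> 0 < \<eta> x \<Longrightarrow> \<bar>h x - f x\<bar> \<le> \<eta> x"
    and nn: "\<And>x. x \<in> X \<Longrightarrow> 0 \<le> \<eta> x"
  shows "continuous_on X (\<lambda>x. if 0 < \<eta> x then h x else f x)"
proof -
  define k where "k x = (if 0 < \<eta> x then h x else f x)" for x
  have kle: "\<bar>k x - f x\<bar> \<le> \<eta> x" if "x \<in> X" for x using le nn that unfolding k_def by auto
  have op: "openin (top_of_set X) {x\<in>X. 0 < \<eta> x}"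
  proof -
    have "X \<inter> \<eta> -` {0<..} = {x\<in>X. 0 < \<eta> x}" by auto
    then show ?thesis using continuous_openin_preimage_gen[OF \<eta>, of "{0<..}"] by simp
  qed
  have "continuous (at x within X) k" if x: "x \<in> X" for x
  proof (cases "0 < \<eta> x")
    case True
    have "continuous_on {x\<in>X. 0 < \<eta> x} k"
      using h by (rule continuous_on_eq) (auto simp: k_def)
    then have "continuous (at x within {x\<in>X. 0 < \<eta> x}) k"
      using True x by (simp add: continuous_on_eq_continuous_within)
    moreover obtain T where T: "open T" "{x\<in>X. 0 < \<eta> x} = X \<inter> T" using op unfolding openin_open by blast
    have "at x within {x\<in>X. 0 < \<eta> x} = at x within X"
      by (rule at_within_nhd[of x T]) (use T True x in auto)
    ultimately show ?thesis by (simp add: continuous_within)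
  next
    case False
    then have z: "\<eta> x = 0" "k x = f x" using nn[OF x] by (auto simp: k_def)
    have "(\<eta> \<longlongrightarrow> 0) (at x within X)" using \<eta> x z by (metis continuous_on)
    then have "((\<lambda>y. k y - f y) \<longlongrightarrow> 0) (at x within X)"
      by (rule Lim_null_comparison[rotated]) (auto simp: eventually_at_filter kle intro!: always_eventually)
    moreover have "(f \<longlongrightarrow> f x) (at x within X)" using f x by (simp add: continuous_on)
    ultimately have "((\<lambda>y. (k y - f y) + f y) \<longlongrightarrow> 0 + f x) (at x within X)" by (rule tendsto_add)
    then show ?thesis using z by (simp add: continuous_within)
  qed
  then show ?thesis unfolding k_def by (simp add: continuous_on_eq_continuous_within)
qed

text \<open>\<open>E\<close> need not be closed, so a function on \<open>E\<close> need not extend; instead a clopen partition of \<open>E\<close>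
  yields separated sets, and the sign of the resulting function is corrected within distance 1 of
  the rescaled \<open>f\<close>.\<close>

lemma perturb_avoiding_value:
  fixes f \<eta> :: "'a::{metric_space,second_countable_topology} \<Rightarrow> real"
  assumes f: "continuous_on X f" and \<eta>: "continuous_on X \<eta>" "\<And>x. x \<in> X \<Longrightarrow> 0 \<le> \<eta> x"
    and E: "E \<subseteq> X" "zero_dimensional_space (top_of_set E)" "\<And>x. x \<in> E \<Longrightarrow> 0 < \<eta> x"
  obtains g where "continuous_on X g" "\<And>x. x \<in> X \<Longrightarrow> \<bar>g x - f x\<bar> \<le> \<eta> x" "\<And>x. x \<in> E \<Longrightarrow> g x \<noteq> r"
proof -
  define M where "M = {x\<in>X. 0 < \<eta> x}"
  have EM: "E \<subseteq> M" using E unfolding M_def by auto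
  \<comment> \<open>After this rescaling the forbidden value is 0 and the permitted deviation is
    1.\<close>
  define p where "p x = (f x - r) / \<eta> x" for x
  have p: "continuous_on M p" unfolding p_def M_def
    by (intro continuous_intros continuous_on_subset[OF f] continuous_on_subset[OF \<eta>(1)]) auto
  have pE: "continuous_on E p" using p EM continuous_on_subset by blast
  have "openin (top_of_set E) (E \<inter> p -` {..<1})" "openin (top_of_set E) (E \<inter> p -` {-1<..})"
    using continuous_openin_preimage_gen[OF pE] by auto
  moreover have "E \<subseteq> (E \<inter> p -` {..<1}) \<union> (E \<inter> p -` {-1<..})" by auto
  ultimately obtain E1 E2 where E12: "openin (top_of_set E) E1" "openin (top_of_set E) E2"
    "E1 \<union> E2 = E" "E1 \<inter> E2 = {}" "E1 \<subseteq> E \<inter> p -` {..<1}" "E2 \<subseteq> E \<inter> p -` {-1<..}"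
    by (rule zero_dimensional_clopen_partition[OF E(2)])
  have sep: "A \<inter> closure B = {}" if AB: "openin (top_of_set E) A" "A \<inter> B = {}" "B \<subseteq> E" for A B
  proof -
    obtain T where T: "open T" "A = E \<inter> T" using AB(1) openin_open by metis
    then have "T \<inter> B = {}" using AB by auto
    then have "T \<inter> closure B = {}" using open_Int_closure_eq_empty[OF T(1), of B] by simp
    then show ?thesis using T by auto
  qed
  have "E1 \<inter> closure E2 = {}" "closure E1 \<inter> E2 = {}"
    using sep[of E1 E2] sep[of E2 E1] E12 by auto
  then obtain q :: "'a \<Rightarrow> real" where q: "continuous_on UNIV q" "\<And>x. x \<in> E1 \<Longrightarrow> q x < 0" "\<And>x. x \<in> E2 \<Longrightarrow> 0 < q x"
    using separated_sets_function by blast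
  \<comment> \<open>This is \<open>q\<close> clamped to the band of radius 1 around
    \<open>p\<close>. Clamping preserves the sign of \<open>q\<close> on \<open>E1\<close>, where
    \<open>p < 1\<close>, and on \<open>E2\<close>, where \<open>p > -1\<close>.\<close>
  define \<psi> where "\<psi> x = max (p x - 1) (min (p x + 1) (q x))" for x
  have \<psi>: "continuous_on M \<psi>" unfolding \<psi>_def
    by (intro continuous_intros p continuous_on_subset[OF q(1)]) auto
  have \<psi>E: "\<psi> x \<noteq> 0" if "x \<in> E" for x
  proof (cases "x \<in> E1")
    case True then show ?thesis using q(2)[OF True] E12(5) by (auto simp: \<psi>_def)
  next
    case False then have "x \<in> E2" using that E12 by auto
    then show ?thesis using q(3)[of x] E12(6) by (auto simp: \<psi>_def)
  qed
  define h where "h x = r + \<eta> x * \<psi> x" for x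
  have h: "continuous_on M h" unfolding h_def
    by (intro continuous_intros \<psi> continuous_on_subset[OF \<eta>(1)]) (auto simp: M_def)
  have hle: "\<bar>h x - f x\<bar> \<le> \<eta> x" if "0 < \<eta> x" for x
  proof -
    have "h x - f x = \<eta> x * (\<psi> x - p x)" using that by (simp add: h_def p_def field_simps)
    moreover have "\<bar>\<psi> x - p x\<bar> \<le> 1" by (auto simp: \<psi>_def)
    ultimately show ?thesis using that by (simp add: abs_mult mult_left_le)
  qed
  define g where "g x = (if 0 < \<eta> x then h x else f x)" for x
  show ?thesis
  proof
    show "continuous_on X g" unfolding g_def
      by (rule continuous_on_replace_within[OF f \<eta>(1)]) (use h hle \<eta>(2) in \<open>auto simp: M_def\<close>)
    show "\<bar>g x - f x\<bar> \<le> \<eta> x" if "x \<in> X" for x using hle \<eta>(2) that by (auto simp: g_def)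
    show "g x \<noteq> r" if "x \<in> E" for x using E(3)[OF that] \<psi>E[OF that] by (auto simp: g_def h_def)
  qed
qed

text \<open>On the part of \<open>C\<close> where \<open>\<eta>\<close> is positive, a locally
  constant selection picks rationals within \<open>\<eta>\<close> of \<open>f\<close>. That part is
  relatively closed in the set where \<open>\<eta>\<close> is positive, so Tietze's theorem extends
  the correction.\<close>

lemma perturb_rational_on_zero_dimensional:
  fixes f \<eta> :: "'a::{metric_space,second_countable_topology} \<Rightarrow> real"
  assumes f: "continuous_on X f" and \<eta>: "continuous_on X \<eta>" "\<And>x. x \<in> X \<Longrightarrow> 0 \<le> \<eta> x"
    and C: "closedin (top_of_set X) C" "zero_dimensional_space (top_of_set {x\<in>C. 0 < \<eta> x})"
  obtains g where "continuous_on X g" "\<And>x. x \<in> X \<Longrightarrow> \<bar>g x - f x\<bar> \<le> \<eta> x"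
    "\<And>x. x \<in> C \<Longrightarrow> 0 < \<eta> x \<Longrightarrow> g x \<in> \<rat>"
proof -
  define M where "M = {x\<in>X. 0 < \<eta> x}"
  define D where "D = {x\<in>C. 0 < \<eta> x}"
  have CX: "C \<subseteq> X" using C closedin_imp_subset by auto
  have DM: "D \<subseteq> M" "D = C \<inter> M" using CX unfolding M_def D_def by auto
  have clD: "closedin (top_of_set M) D"
    using C(1) unfolding DM(2) by (auto simp: closedin_closed M_def)
  have fM: "continuous_on M f" "continuous_on M \<eta>"
    using f \<eta>(1) continuous_on_subset unfolding M_def by (metis (mono_tags, lifting) mem_Collect_eq subsetI)+
  have fD: "continuous_on D f" "continuous_on D \<eta>"
    using fM DM continuous_on_subset by blast+
  have op: "openin (top_of_set D) {x\<in>D. \<bar>q - f x\<bar> < \<eta> x}" for q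
  proof -
    have "continuous_on D (\<lambda>x. \<eta> x - \<bar>q - f x\<bar>)" by (intro continuous_intros fD)
    then have "openin (top_of_set D) (D \<inter> (\<lambda>x. \<eta> x - \<bar>q - f x\<bar>) -` {0<..})"
      by (rule continuous_openin_preimage_gen) auto
    moreover have "D \<inter> (\<lambda>x. \<eta> x - \<bar>q - f x\<bar>) -` {0<..} = {x\<in>D. \<bar>q - f x\<bar> < \<eta> x}" by auto
    ultimately show ?thesis by simp
  qed
  have cov: "D \<subseteq> (\<Union>q\<in>\<rat>. {x\<in>D. \<bar>q - f x\<bar> < \<eta> x})"
  proof
    fix x assume x: "x \<in> D"
    then have "f x - \<eta> x < f x + \<eta> x" by (auto simp: D_def)
    then obtain q where "q \<in> \<rat>" "f x - \<eta> x < q" "q < f x + \<eta> x" using Rats_dense_in_real by blast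
    then show "x \<in> (\<Union>q\<in>\<rat>. {x\<in>D. \<bar>q - f x\<bar> < \<eta> x})"
      using x by (intro UN_I[of q]) auto
  qed
  have "\<exists>s. (\<forall>x\<in>D. s x \<in> \<rat> \<and> x \<in> {y\<in>D. \<bar>s x - f y\<bar> < \<eta> y}) \<and>
      (\<forall>J. openin (top_of_set D) {x\<in>D. s x \<in> J})"
  proof (rule zero_dimensional_selection[where U = "\<lambda>q. {x\<in>D. \<bar>q - f x\<bar> < \<eta> x}"])
    show "zero_dimensional_space (top_of_set D)" using C(2) unfolding D_def .
  qed (use op cov in auto)
  then obtain s where s: "\<And>x. x \<in> D \<Longrightarrow> s x \<in> \<rat> \<and> \<bar>s x - f x\<bar> < \<eta> x"
    and sop: "\<And>J. openin (top_of_set D) {x\<in>D. s x \<in> J}"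
    by auto
  have cs: "continuous_on D s"
    unfolding continuous_openin_preimage_eq
  proof (intro allI impI)
    fix T :: "real set"
    have "D \<inter> s -` T = {x\<in>D. s x \<in> T}" by auto
    then show "openin (top_of_set D) (D \<inter> s -` T)" using sop by simp
  qed
  have \<eta>0: "\<eta> x > 0" if "x \<in> M" for x using that by (auto simp: M_def)
  \<comment> \<open>Extending the quotient instead of \<open>s\<close> turns the variable bound
    \<open>\<eta>\<close> into the constant bound 1, which Tietze's theorem preserves.\<close>
  have "continuous_on D (\<lambda>x. (s x - f x) / \<eta> x)"
    by (intro continuous_intros cs fD) (use \<eta>0 DM in force)
  moreover have "norm ((s x - f x) / \<eta> x) \<le> 1" if "x \<in> D" for x
    using s[OF that] \<eta>0[of x] DM that by (auto simp: divide_le_eq)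
  ultimately obtain t where t: "continuous_on M t" "\<And>x. x \<in> D \<Longrightarrow> t x = (s x - f x) / \<eta> x"
    "\<And>x. x \<in> M \<Longrightarrow> norm (t x) \<le> 1"
    using Tietze[of D "\<lambda>x. (s x - f x) / \<eta> x" M 1] clD by (metis (no_types, lifting) zero_le_one)
  define h where "h x = f x + \<eta> x * t x" for x
  have h: "continuous_on M h" unfolding h_def by (intro continuous_intros fM t)
  have hle: "\<bar>h x - f x\<bar> \<le> \<eta> x" if "x \<in> M" for x
    using t(3)[OF that] \<eta>0[OF that] by (simp add: h_def abs_mult mult_left_le)
  define g where "g x = (if 0 < \<eta> x then h x else f x)" for x
  show ?thesis
  proof
    show "continuous_on X g" unfolding g_def
      by (rule continuous_on_replace_within[OF f \<eta>(1)]) (use h hle \<eta>(2) in \<open>auto simp: M_def\<close>)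
    show "\<bar>g x - f x\<bar> \<le> \<eta> x" if "x \<in> X" for x
      using hle \<eta>(2) that by (auto simp: g_def M_def)
    show "g x \<in> \<rat>" if "x \<in> C" "0 < \<eta> x" for x
    proof -
      have "x \<in> D" using that by (auto simp: D_def)
      then have "g x = s x" using t(2)[of x] that(2) by (simp add: g_def h_def)
      then show ?thesis using s \<open>x \<in> D\<close> by auto
    qed
  qed
qed

text \<open>The modulus \<open>\<eta>\<close> bounds all later changes of \<open>f\<close>: where it vanishes the value of \<open>f\<close> is frozen (and
  rational), and where it does not, the last condition keeps the value away from \<open>r\<close> forever.\<close>

lemma perturbation_step:
  fixes f \<eta> :: "'a::{metric_space,second_countable_topology} \<Rightarrow> real"
  assumes f: "continuous_on X f" and \<eta>: "continuous_on X \<eta>" "\<And>x. x \<in> X \<Longrightarrow> 0 \<le> \<eta> x"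
    and rat: "\<And>x. x \<in> X \<Longrightarrow> \<eta> x = 0 \<Longrightarrow> f x \<in> \<rat>"
    and E: "E \<subseteq> X" "zero_dimensional_space (top_of_set E)" "\<And>x. x \<in> E \<Longrightarrow> 0 < \<eta> x"
    and C: "closedin (top_of_set X) C" "C \<inter> E = {}" "zero_dimensional_space (top_of_set {x\<in>C. 0 < \<eta> x})"
    and r: "r \<in> \<rat>"
  obtains f' \<eta>' where "continuous_on X f'" "continuous_on X \<eta>'"
    "\<And>x. x \<in> X \<Longrightarrow> \<bar>f' x - f x\<bar> \<le> \<eta> x" "\<And>x. x \<in> X \<Longrightarrow> 0 \<le> \<eta>' x" "\<And>x. x \<in> X \<Longrightarrow> \<eta>' x \<le> \<eta> x / 2"
    "\<And>x. x \<in> E \<Longrightarrow> 0 < \<eta>' x" "\<And>x. x \<in> C \<Longrightarrow> \<eta>' x = 0"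
    "\<And>x. x \<in> X \<Longrightarrow> \<eta>' x = 0 \<Longrightarrow> f' x \<in> \<rat>"
    "\<And>x. x \<in> X \<Longrightarrow> 0 < \<eta>' x \<Longrightarrow> 2 * \<eta>' x < \<bar>f' x - r\<bar>"
proof -
  obtain g where g: "continuous_on X g" "\<And>x. x \<in> X \<Longrightarrow> \<bar>g x - f x\<bar> \<le> \<eta> x / 2" "\<And>x. x \<in> E \<Longrightarrow> g x \<noteq> r"
  proof (rule perturb_avoiding_value[of X f "\<lambda>x. \<eta> x / 2" E r])
    show "continuous_on X (\<lambda>x. \<eta> x / 2)" by (intro continuous_intros \<eta>) auto
  qed (use f \<eta> E in auto)
  \<comment> \<open>The first change used at most half of \<open>\<eta>\<close>. The second one may
    use the other half, but at most half of the distance from \<open>g\<close> to \<open>r\<close>,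
    so that it cannot undo the avoidance of \<open>r\<close>.\<close>
  define \<theta> where "\<theta> x = min (\<eta> x) \<bar>g x - r\<bar> / 2" for x
  have \<theta>c: "continuous_on X \<theta>" unfolding \<theta>_def by (intro continuous_intros \<eta> g) auto
  have \<theta>0: "0 \<le> \<theta> x" if "x \<in> X" for x using \<eta>(2)[OF that] by (auto simp: \<theta>_def)
  have "zero_dimensional_space (top_of_set {x\<in>C. 0 < \<theta> x})"
    by (rule zero_dimensional_space_subset[OF C(3)]) (auto simp: \<theta>_def)
  then obtain h where h: "continuous_on X h" "\<And>x. x \<in> X \<Longrightarrow> \<bar>h x - g x\<bar> \<le> \<theta> x" "\<And>x. x \<in> C \<Longrightarrow> 0 < \<theta> x \<Longrightarrow> h x \<in> \<rat>"
    using perturb_rational_on_zero_dimensional[OF g(1) \<theta>c \<theta>0 C(1)] by blast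
  obtain d :: "'a \<Rightarrow> real" where dc: "continuous_on X d" and d01: "\<And>x. 0 \<le> d x \<and> d x \<le> 1"
    and dz: "\<And>x. x \<in> X \<Longrightarrow> d x = 0 \<longleftrightarrow> x \<in> C"
    using closedin_zero_set[OF C(1)] by metis
  then have d0: "0 \<le> d x" for x by simp
  \<comment> \<open>The three terms halve the modulus, keep later changes away from
    \<open>r\<close>, and freeze the function on \<open>C\<close>. The factor 8 leaves room:
    \<open>h\<close> keeps at least half of the distance from \<open>g\<close> to \<open>r\<close>,
    and twice the new modulus is at most a quarter of it.\<close>
  define \<eta>' where "\<eta>' x = min (min (\<eta> x / 2) (\<bar>g x - r\<bar> / 8)) (d x)" for x
  have \<eta>0: "\<eta>' x = 0 \<Longrightarrow> \<eta> x = 0 \<or> g x = r \<or> x \<in> C" if "x \<in> X" for x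
    using dz[OF that] by (auto simp: \<eta>'_def min_def split: if_splits)
  show ?thesis
  proof
    show "continuous_on X h" by fact
    show "continuous_on X \<eta>'" unfolding \<eta>'_def by (intro continuous_intros \<eta> g dc) auto
    have \<theta>le: "\<theta> x \<le> \<eta> x / 2" "\<theta> x \<le> \<bar>g x - r\<bar> / 2" for x by (auto simp: \<theta>_def)
    show "\<bar>h x - f x\<bar> \<le> \<eta> x" if "x \<in> X" for x
      using h(2)[OF that] g(2)[OF that] \<theta>le(1)[of x] by linarith
    show "0 \<le> \<eta>' x" if "x \<in> X" for x using \<eta>(2)[OF that] d0 by (auto simp: \<eta>'_def)
    show "\<eta>' x \<le> \<eta> x / 2" if "x \<in> X" for x by (auto simp: \<eta>'_def)
    show "0 < \<eta>' x" if "x \<in> E" for x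
    proof -
      have "x \<in> X" "x \<notin> C" using that E C by auto
      then have "0 < d x" using dz[of x] d0[of x] by linarith
      then show ?thesis using E(3)[OF that] g(3)[OF that] by (auto simp: \<eta>'_def)
    qed
    show "\<eta>' x = 0" if "x \<in> C" for x
    proof -
      have "x \<in> X" using that C(1) closedin_imp_subset by blast
      then show ?thesis using \<eta>(2)[of x] dz[of x] that by (auto simp: \<eta>'_def)
    qed
    \<comment> \<open>The new modulus vanishes in three cases: the value was frozen before,
      \<open>g\<close> has the rational value \<open>r\<close>, or the point lies in
      \<open>C\<close>. In the first two \<open>\<theta>\<close> is 0 and \<open>h\<close> equals
      \<open>g\<close>; otherwise \<open>h\<close> was made rational on \<open>C\<close>.\<close>
    show "h x \<in> \<rat>" if x: "x \<in> X" "\<eta>' x = 0" for x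
    proof (cases "\<theta> x = 0")
      case True
      then have hg: "h x = g x" using h(2)[OF x(1)] by simp
      show ?thesis
      proof (cases "g x = r")
        case False
        then have "\<eta> x = 0" using True \<eta>(2)[OF x(1)] by (auto simp: \<theta>_def min_def split: if_splits)
        then show ?thesis using g(2)[OF x(1)] rat[OF x(1)] hg by simp
      qed (use hg r in simp)
    next
      case False
      then have "0 < \<theta> x" using \<theta>0 x by force
      moreover from False have "\<eta> x \<noteq> 0" "g x \<noteq> r" using \<eta>(2)[OF x(1)] by (auto simp: \<theta>_def)
      ultimately show ?thesis using \<eta>0[OF x] h(3) by auto
    qed
    show "2 * \<eta>' x < \<bar>h x - r\<bar>" if "x \<in> X" "0 < \<eta>' x" for x
    proof -
      have "\<bar>g x - r\<bar> > 0" using that by (auto simp: \<eta>'_def)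
      moreover have "\<bar>h x - g x\<bar> \<le> \<bar>g x - r\<bar> / 2" using h(2)[OF that(1)] \<theta>le(2)[of x] by linarith
      moreover have "\<eta>' x \<le> \<bar>g x - r\<bar> / 8" unfolding \<eta>'_def by (meson min.cobounded1 min.cobounded2 order_trans)
      moreover have "\<bar>g x - r\<bar> \<le> \<bar>h x - r\<bar> + \<bar>h x - g x\<bar>" by arith
      moreover have "\<And>a b c e::real. 0 < a \<Longrightarrow> b \<le> a / 2 \<Longrightarrow> e \<le> a / 8 \<Longrightarrow> a \<le> c + b \<Longrightarrow> 2 * e < c"
        by linarith
      ultimately show ?thesis by blast
    qed
  qed
qed

lemma irrational_rational_function:
  fixes X A E :: "'a::{metric_space,second_countable_topology} set"
  assumes A: "closedin (top_of_set X) A"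
    and E: "gdelta_in (top_of_set X) E" "E \<inter> A = {}" "zero_dimensional_space (top_of_set E)"
    and F: "zero_dimensional_space (top_of_set (X - A - E))"
  obtains g :: "'a \<Rightarrow> real" where "continuous_on X g" "\<And>x. x \<in> X \<Longrightarrow> 0 \<le> g x \<and> g x \<le> 1"
    "\<And>x. x \<in> X \<Longrightarrow> g x = 0 \<longleftrightarrow> x \<in> A" "\<And>x. x \<in> E \<Longrightarrow> g x \<notin> \<rat>" "\<And>x. x \<in> X - E \<Longrightarrow> g x \<in> \<rat>"
proof -
  have EX: "E \<subseteq> X" using gdelta_in_subset[OF E(1)] by simp
  have "fsigma_in (top_of_set X) (X - E)"
    using E(1) gdelta_in_fsigma_in[of "top_of_set X" E] by simp
  then obtain C :: "nat \<Rightarrow> 'a set" where C: "\<And>n. closedin (top_of_set X) (C n)" "\<Union>(range C) = X - E"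
    unfolding fsigma_in_ascending by blast
  have CE: "C n \<inter> E = {}" "C n \<subseteq> X" for n using C(2) by auto
  obtain a :: "'a \<Rightarrow> real" where ac: "continuous_on X a" and a0: "\<And>x. 0 \<le> a x \<and> a x \<le> 1"
    and az: "\<And>x. x \<in> X \<Longrightarrow> a x = 0 \<longleftrightarrow> x \<in> A"
    using closedin_zero_set[OF A] by metis
  then have a01: "0 \<le> a x" "a x \<le> 1" for x by simp_all
  obtain r :: "nat \<Rightarrow> real" where r: "range r = \<rat>"
    using countable_rat uncountable_def by (metis Rats_0 empty_iff)
  define good where "good p \<longleftrightarrow> continuous_on X (fst p) \<and> continuous_on X (snd p) \<and>
     (\<forall>x\<in>X. 0 \<le> snd p x) \<and> (\<forall>x\<in>A. snd p x = 0) \<and> (\<forall>x\<in>E. 0 < snd p x) \<and>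
     (\<forall>x\<in>X. snd p x = 0 \<longrightarrow> fst p x \<in> \<rat>)" for p :: "('a \<Rightarrow> real) \<times> ('a \<Rightarrow> real)"
  \<comment> \<open>Stage \<open>n\<close> treats \<open>C n\<close> and \<open>r n\<close>
    together: the modulus becomes 0 on \<open>C n\<close>, and where it stays positive it is small
    enough to exclude the value \<open>r n\<close> for good.\<close>
  define refines where "refines n p q \<longleftrightarrow> (\<forall>x\<in>X. \<bar>fst q x - fst p x\<bar> \<le> snd p x) \<and> (\<forall>x\<in>X. snd q x \<le> snd p x / 2) \<and>
     (\<forall>x\<in>C n. snd q x = 0) \<and> (\<forall>x\<in>X. 0 < snd q x \<longrightarrow> 2 * snd q x < \<bar>fst q x - r n\<bar>)"
    for n and p q :: "('a \<Rightarrow> real) \<times> ('a \<Rightarrow> real)"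
  \<comment> \<open>With initial modulus \<open>a x / 8\<close> the total change is at most
    \<open>a x / 4\<close>. The limit thus lies between \<open>a x / 4\<close> and
    \<open>3 * a x / 4\<close>, so it stays in the unit interval and vanishes exactly where
    \<open>a\<close> does.\<close>
  have "\<exists>P. P 0 = (\<lambda>x. a x / 2, \<lambda>x. a x / 8) \<and> (\<forall>n. good (P n) \<and> refines n (P n) (P (Suc n)))"
  proof -
    have base: "good (\<lambda>x. a x / 2, \<lambda>x. a x / 8)"
    proof -
      have "a x = 0" if "x \<in> A" for x using az that closedin_imp_subset[OF A] by auto
      moreover have "0 < a x" if "x \<in> E" for x using az[of x] a01(1)[of x] that EX E(2) by force
      ultimately show ?thesis
        unfolding good_def using a01 az by (auto intro!: continuous_intros ac)
    qed
    have step: "\<exists>q. good q \<and> refines n p q" if p: "good p" for n p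
    proof -
      have "{x \<in> C n. 0 < snd p x} \<subseteq> X - A - E" using p CE unfolding good_def by auto
      then have zd: "zero_dimensional_space (top_of_set {x \<in> C n. 0 < snd p x})"
        using F zero_dimensional_space_subset by blast
      have rn: "r n \<in> \<rat>" using r by auto
      have pp: "continuous_on X (fst p)" "continuous_on X (snd p)" "\<And>x. x \<in> X \<Longrightarrow> 0 \<le> snd p x"
        "\<And>x. x \<in> X \<Longrightarrow> snd p x = 0 \<Longrightarrow> fst p x \<in> \<rat>" "\<And>x. x \<in> E \<Longrightarrow> 0 < snd p x"
        and pA: "\<And>x. x \<in> A \<Longrightarrow> snd p x = 0"
        using p unfolding good_def by blast+
      obtain f' \<eta>' where q: "continuous_on X f'" "continuous_on X \<eta>'"
        "\<And>x. x \<in> X \<Longrightarrow> \<bar>f' x - fst p x\<bar> \<le> snd p x" "\<And>x. x \<in> X \<Longrightarrow> 0 \<le> \<eta>' x" "\<And>x. x \<in> X \<Longrightarrow> \<eta>' x \<le> snd p x / 2"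
        "\<And>x. x \<in> E \<Longrightarrow> 0 < \<eta>' x" "\<And>x. x \<in> C n \<Longrightarrow> \<eta>' x = 0"
        "\<And>x. x \<in> X \<Longrightarrow> \<eta>' x = 0 \<Longrightarrow> f' x \<in> \<rat>"
        "\<And>x. x \<in> X \<Longrightarrow> 0 < \<eta>' x \<Longrightarrow> 2 * \<eta>' x < \<bar>f' x - r n\<bar>"
        by (rule perturbation_step[OF pp(1-4) EX E(3) pp(5) C(1) CE(1) zd rn]) (assumption | rule that)+
      have "\<forall>x\<in>A. \<eta>' x = 0"
      proof
        fix x assume x: "x \<in> A"
        then have "x \<in> X" using closedin_imp_subset[OF A] by auto
        then show "\<eta>' x = 0" using q(4,5)[of x] pA[OF x] by simp
      qed
      then have "good (f', \<eta>')" "refines n p (f', \<eta>')" unfolding good_def refines_def using q by auto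
      then show ?thesis by blast
    qed
    show ?thesis using dependent_nat_choice[of "\<lambda>n p. good p \<and> (n = 0 \<longrightarrow> p = (\<lambda>x. a x / 2, \<lambda>x. a x / 8))" refines] base step
      by auto
  qed
  then obtain P where P0: "P 0 = (\<lambda>x. a x / 2, \<lambda>x. a x / 8)" and P: "\<And>n. good (P n)" "\<And>n. refines n (P n) (P (Suc n))" by blast
  define f \<eta> where "f n = fst (P n)" and "\<eta> n = snd (P n)" for n
  have fc: "continuous_on X (f n)" for n using P unfolding good_def f_def by auto
  have \<eta>0: "0 \<le> \<eta> n x" if "x \<in> X" for n x using P that unfolding good_def \<eta>_def by auto
  have \<eta>E: "0 < \<eta> n x" if "x \<in> E" for n x using P that unfolding good_def \<eta>_def by auto
  have frat: "f n x \<in> \<rat>" if "x \<in> X" "\<eta> n x = 0" for n x using P that unfolding good_def f_def \<eta>_def by auto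
  have fs: "\<bar>f (Suc n) x - f n x\<bar> \<le> \<eta> n x" if "x \<in> X" for n x using P(2) that unfolding refines_def f_def \<eta>_def by auto
  have \<eta>s: "\<eta> (Suc n) x \<le> \<eta> n x / 2" if "x \<in> X" for n x using P(2) that unfolding refines_def \<eta>_def by auto
  have \<eta>C: "\<eta> (Suc n) x = 0" if "x \<in> C n" for n x using P(2) that unfolding refines_def \<eta>_def by auto
  have far: "2 * \<eta> (Suc n) x < \<bar>f (Suc n) x - r n\<bar>" if "x \<in> X" "0 < \<eta> (Suc n) x" for n x
    using P(2) that unfolding refines_def f_def \<eta>_def by auto
  have \<eta>k: "\<eta> (n + k) x \<le> \<eta> n x * (1/2)^k" if "x \<in> X" for n k x
    by (induction k) (use \<eta>s[OF that] in \<open>auto intro: order_trans\<close>)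
  \<comment> \<open>The moduli at least halve at every stage, so the changes are dominated by a
    geometric series with sum twice the modulus.\<close>
  have fk: "\<bar>f (n + k) x - f n x\<bar> \<le> \<eta> n x * (2 - 2 * (1/2)^k)" if x: "x \<in> X" for n k x
  proof (induction k)
    case (Suc k)
    have "\<bar>f (n + Suc k) x - f n x\<bar> \<le> \<eta> (n + k) x + \<eta> n x * (2 - 2 * (1/2)^k)"
      using fs[OF x, of "n + k"] Suc by simp
    also have "\<dots> \<le> \<eta> n x * (1/2)^k + \<eta> n x * (2 - 2 * (1/2)^k)" using \<eta>k[OF x] by simp
    also have "\<dots> = \<eta> n x * (2 - 2 * (1/2)^Suc k)" by (simp add: algebra_simps)
    finally show ?case .
  qed simp
  have fk2: "\<bar>f m x - f n x\<bar> \<le> 2 * \<eta> n x" if x: "x \<in> X" "n \<le> m" for n m x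
  proof -
    have "\<eta> n x * (2 - 2 * (1/2)^(m - n)) \<le> \<eta> n x * 2" using \<eta>0[OF x(1)] by (intro mult_left_mono) auto
    then show ?thesis using fk[OF x(1), of n "m - n"] x(2) by simp
  qed
  have \<eta>small: "2 * \<eta> n x \<le> (1/2)^n" if "x \<in> X" for n x
  proof -
    have "\<eta> 0 x \<le> 1/8" using a01(2)[of x] P0 by (simp add: \<eta>_def)
    then have "\<eta> 0 x * (1/2)^n \<le> 1/2 * (1/2)^n" by (intro mult_right_mono) auto
    moreover have "\<eta> n x \<le> \<eta> 0 x * (1/2)^n" using \<eta>k[OF that, of 0 n] by simp
    ultimately show ?thesis by linarith
  qed
  have "uniformly_Cauchy_on X f"
  proof (rule uniformly_Cauchy_onI)
    fix e :: real assume "0 < e"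
    then obtain N where N: "(1/2)^N < e / 2" using real_arch_pow_inv[of "e/2" "1/2"] by auto
    have "dist (f m x) (f n x) < e" if "x \<in> X" "m \<ge> N" "n \<ge> N" for x m n
    proof -
      have "\<bar>f m x - f N x\<bar> \<le> (1/2)^N" "\<bar>f n x - f N x\<bar> \<le> (1/2)^N"
        using fk2[OF that(1), of N] \<eta>small[OF that(1), of N] that by (meson order_trans)+
      then show ?thesis using N unfolding dist_real_def by linarith
    qed
    then show "\<exists>M. \<forall>x\<in>X. \<forall>m\<ge>M. \<forall>n\<ge>M. dist (f m x) (f n x) < e" by blast
  qed
  then obtain g where ul: "uniform_limit X f g sequentially"
    using uniformly_convergent_eq_Cauchy uniformly_convergent_on_def by blast
  have gc: "continuous_on X g" by (rule uniform_limit_theorem[OF _ ul]) (use fc in auto)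
  have lim: "(\<lambda>n. f n x) \<longlonglongrightarrow> g x" if "x \<in> X" for x using tendsto_uniform_limitI[OF ul that] .
  have gf: "\<bar>g x - f n x\<bar> \<le> 2 * \<eta> n x" if x: "x \<in> X" for x n
  proof -
    have "(\<lambda>m. \<bar>f m x - f n x\<bar>) \<longlonglongrightarrow> \<bar>g x - f n x\<bar>" by (intro tendsto_intros lim x)
    then show ?thesis
      by (rule tendsto_upperbound) (auto intro!: eventually_sequentiallyI[of n] fk2 x)
  qed
  have g0: "\<bar>g x - a x / 2\<bar> \<le> a x / 4" if "x \<in> X" for x
    using gf[OF that, of 0] P0 by (simp add: f_def \<eta>_def)
  show ?thesis
  proof
    show "continuous_on X g" by fact
    show "0 \<le> g x \<and> g x \<le> 1" if "x \<in> X" for x using g0[OF that] a01[of x] by linarith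
    show "g x = 0 \<longleftrightarrow> x \<in> A" if "x \<in> X" for x
      using g0[OF that] a01[of x] az[OF that] by (auto simp: abs_if split: if_splits)
    \<comment> \<open>A rational value \<open>r n\<close> was excluded at stage \<open>n\<close>:
      the limit is within twice the modulus of \<open>f (Suc n)\<close>, while \<open>r n\<close> is
      farther away.\<close>
    show "g x \<notin> \<rat>" if "x \<in> E" for x
    proof
      assume "g x \<in> \<rat>"
      then obtain n where "g x = r n" using r by (metis imageE)
      then show False using far[of x n] gf[of x "Suc n"] \<eta>E[OF that] that EX by (auto simp: abs_minus_commute)
    qed
    show "g x \<in> \<rat>" if "x \<in> X - E" for x
    proof -
      have "x \<in> \<Union>(range C)" using C(2) that by simp
      then obtain n where "x \<in> C n" by blast
      then have z: "\<eta> (Suc n) x = 0" using \<eta>C by auto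
      then have "g x = f (Suc n) x" using gf[of x "Suc n"] that by auto
      then show ?thesis using frat z that by auto
    qed
  qed
qed

subsection \<open>Embeddings into sequence spaces\<close>

text \<open>The condition \<open>W\<close> says that open sets can be recovered from the images of
  points. Applied to the complement of a point, which is open in a T1 space, it also gives
  injectivity.\<close>

lemma embedding_map_euclideanI:
  fixes f :: "'a \<Rightarrow> 'b::topological_space"
  assumes f: "continuous_map X euclidean f" and X: "t1_space X"
    and W: "\<And>V x. openin X V \<Longrightarrow> x \<in> V \<Longrightarrow> \<exists>W. open W \<and> f x \<in> W \<and> (\<forall>y\<in>topspace X. f y \<in> W \<longrightarrow> y \<in> V)"
  shows "embedding_map X euclidean f"
  unfolding embedding_map_def
proof (rule bijective_open_imp_homeomorphic_map)
  show "continuous_map X (top_of_set (f ` topspace X)) f"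
    using f by (simp add: continuous_map_in_subtopology)
  show "f ` topspace X = topspace (top_of_set (f ` topspace X))" by simp
  show "inj_on f (topspace X)"
  proof (rule inj_onI, rule ccontr)
    fix x y assume xy: "x \<in> topspace X" "y \<in> topspace X" "f x = f y" "x \<noteq> y"
    have "openin X (topspace X - {y})"
      using X xy(2) by (metis t1_space_closedin_singleton closedin_def)
    then show False using W[of "topspace X - {y}" x] xy by auto
  qed
  show "open_map X (top_of_set (f ` topspace X)) f"
    unfolding open_map_def
  proof (intro allI impI)
    fix V assume V: "openin X V"
    show "openin (top_of_set (f ` topspace X)) (f ` V)"
    proof (subst openin_subopen, intro ballI)
      fix z assume "z \<in> f ` V"
      then obtain x where x: "x \<in> V" "z = f x" by auto
      then obtain W where W: "open W" "f x \<in> W" "\<forall>y\<in>topspace X. f y \<in> W \<longrightarrow> y \<in> V" using W[OF V] by metis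
      have "x \<in> topspace X" using V x openin_subset by auto
      then show "\<exists>T. openin (top_of_set (f ` topspace X)) T \<and> z \<in> T \<and> T \<subseteq> f ` V"
        using W x by (intro exI[of _ "f ` topspace X \<inter> W"]) (auto intro: openin_open_Int)
    qed
  qed
qed

text \<open>A point is sent to its distances to a countable dense set. If it is within half a radius
  of a dense point, the open condition on that one coordinate confines all other points to the
  ball.\<close>

lemma separable_metrizable_embedding:
  assumes "separable_space X" "metrizable_space X"
  obtains e :: "'a \<Rightarrow> nat \<Rightarrow> real" where "embedding_map X euclidean e"
proof -
  obtain M d where M: "Metric_space M d" "X = Metric_space.mtopology M d"
    using assms(2) unfolding metrizable_space_def by metis
  interpret Metric_space M d by fact
  obtain D where D: "countable D" "D \<subseteq> M" "mtopology closure_of D = M"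
    using assms(1) unfolding separable_space_def M(2) by auto
  define s where "s = from_nat_into D"
  \<comment> \<open>The default 0 matters only for the empty space, where
    \<open>from_nat_into\<close> returns an arbitrary value.\<close>
  define e where "e x n = (if s n \<in> M then d x (s n) else 0)" for x n
  have sD: "x \<in> M \<Longrightarrow> 0 < r \<Longrightarrow> \<exists>n. s n \<in> M \<and> d x (s n) < r" for x r
  proof -
    assume x: "x \<in> M" "0 < r"
    then have "x \<in> mtopology closure_of D" using D by simp
    then obtain y where y: "y \<in> D" "y \<in> mball x r" using x unfolding metric_closure_of by blast
    then obtain n where "s n = y" unfolding s_def using D(1) from_nat_into_surj by metis
    then show ?thesis using y D by (auto simp: in_mball)
  qed
  have "embedding_map X euclidean e"
  proof (rule embedding_map_euclideanI)
    have "continuous_map mtopology euclideanreal (\<lambda>x. e x n)" for n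
    proof (cases "s n \<in> M")
      case True
      have "continuous_map mtopology euclideanreal (\<lambda>x. mdist Self x (s n))"
        by (intro continuous_map_mdist) (use True in \<open>auto simp: mtopology_of_def\<close>)
      then show ?thesis using True by (simp add: e_def)
    qed (simp add: e_def)
    then show "continuous_map X euclidean e"
      unfolding M(2) euclidean_product_topology[symmetric] by (subst continuous_map_componentwise_UNIV) simp
    show "t1_space X" using M(2) Hausdorff_imp_t1_space Hausdorff_space_mtopology by blast
    fix V x assume V: "openin X V" "x \<in> V"
    then obtain r where r: "0 < r" "mball x r \<subseteq> V" and x: "x \<in> M" unfolding M(2) openin_mtopology by blast
    obtain n where n: "s n \<in> M" "d x (s n) < r / 2" using sD[OF x, of "r/2"] r by auto
    show "\<exists>W. open W \<and> e x \<in> W \<and> (\<forall>y\<in>topspace X. e y \<in> W \<longrightarrow> y \<in> V)"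
    proof (intro exI conjI ballI impI)
      show "open {w::nat \<Rightarrow> real. w n < r / 2}"
        by (intro open_Collect_less continuous_on_product_coordinates continuous_intros)
      show "e x \<in> {w. w n < r / 2}" using n by (simp add: e_def)
      fix y assume y: "y \<in> topspace X" "e y \<in> {w. w n < r / 2}"
      then have "y \<in> M" "d y (s n) < r / 2" using n M(2) by (auto simp: e_def)
      then have "d x y < r" using triangle[OF x n(1), of y] n commute by fastforce
      then show "y \<in> V" using r \<open>y \<in> M\<close> x by (auto simp: in_mball)
    qed
  qed
  then show ?thesis using that by blast
qed

section \<open>Irrational and rational sequences, and maps into them\<close>

lemma mem_irrational_seqs: "x \<in> irrational_seqs \<longleftrightarrow> (\<forall>n. 0 \<le> x n \<and> x n \<le> 1 \<and> x n \<notin> \<rat>)"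
  by (auto simp: irrational_seqs_def PiE_iff)

lemma mem_rational_seqs: "x \<in> rational_seqs \<longleftrightarrow> (\<forall>n. 0 \<le> x n \<and> x n \<le> 1 \<and> x n \<in> \<rat>)"
  by (auto simp: rational_seqs_def PiE_iff)

lemma PQ_space_eq: "PQ_space = top_of_set (irrational_seqs \<union> rational_seqs)"
proof -
  have "hilbert_cube = top_of_set (\<Pi>\<^sub>E n\<in>UNIV. {0..1})"
    unfolding hilbert_cube_def subtopology_product_topology euclidean_product_topology[symmetric] ..
  moreover have "irrational_seqs \<union> rational_seqs \<subseteq> (\<Pi>\<^sub>E n\<in>UNIV. {0..1})"
    by (auto simp: mem_irrational_seqs mem_rational_seqs PiE_iff)
  ultimately show ?thesis unfolding PQ_space_def by (metis inf.absorb_iff2 subtopology_subtopology)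
qed

text \<open>First \<open>f\<close> is moved by at most 1 to avoid 0 on \<open>E\<close>; the zero
  set \<open>A\<close> of the result is then a partition missing \<open>E\<close>. The function
  \<open>g\<close> vanishing on \<open>A\<close> is folded around 1/2 by the sign of
  \<open>\<psi>\<close>, so the side of 1/2 on which \<open>u\<close> lies tells the sign of
  \<open>\<psi>\<close>.\<close>

lemma irrational_rational_separating_function:
  fixes X E :: "'a::{metric_space,second_countable_topology} set" and f :: "'a \<Rightarrow> real"
  assumes E: "gdelta_in (top_of_set X) E" "zero_dimensional_space (top_of_set E)"
    and F: "zero_dimensional_space (top_of_set (X - E))" and f: "continuous_on X f"
  shows "\<exists>u::'a \<Rightarrow> real. continuous_on X u \<and> (\<forall>x\<in>X. 0 \<le> u x \<and> u x \<le> 1) \<and>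
    (\<forall>x\<in>E. u x \<notin> \<rat>) \<and> (\<forall>x\<in>X - E. u x \<in> \<rat>) \<and>
    (\<forall>x\<in>X. (f x \<le> -2 \<longrightarrow> u x < 1/2) \<and> (2 \<le> f x \<longrightarrow> 1/2 < u x) \<and>
       (u x < 1/2 \<longrightarrow> f x < 1) \<and> (1/2 < u x \<longrightarrow> -1 < f x))"
proof -
  have EX: "E \<subseteq> X" using gdelta_in_subset[OF E(1)] by simp
  obtain \<psi> where \<psi>: "continuous_on X \<psi>" "\<And>x. x \<in> X \<Longrightarrow> \<bar>\<psi> x - f x\<bar> \<le> 1" "\<And>x. x \<in> E \<Longrightarrow> \<psi> x \<noteq> 0"
    using perturb_avoiding_value[of X f "\<lambda>_. 1" E 0] f E EX by auto
  define A where "A = {x \<in> X. \<psi> x = 0}"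
  have A: "closedin (top_of_set X) A" unfolding A_def using continuous_closedin_preimage_constant[OF \<psi>(1)] .
  have EA: "E \<inter> A = {}" using \<psi>(3) by (auto simp: A_def)
  have zF: "zero_dimensional_space (top_of_set (X - A - E))"
    using F by (rule zero_dimensional_space_subset) auto
  obtain g :: "'a \<Rightarrow> real" where g: "continuous_on X g" "\<And>x. x \<in> X \<Longrightarrow> 0 \<le> g x \<and> g x \<le> 1"
    "\<And>x. x \<in> X \<Longrightarrow> g x = 0 \<longleftrightarrow> x \<in> A" "\<And>x. x \<in> E \<Longrightarrow> g x \<notin> \<rat>" "\<And>x. x \<in> X - E \<Longrightarrow> g x \<in> \<rat>"
    by (rule irrational_rational_function[OF A E(1) EA E(2) zF]) (assumption | rule that)+
  \<comment> \<open>Both branches equal 1/2 where \<open>\<psi>\<close> is 0, because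
    \<open>g\<close> vanishes there.\<close>
  define u where "u x = (if \<psi> x \<le> 0 then 1/2 - g x / 2 else 1/2 + g x / 2)" for x
  have uc: "continuous_on X u" unfolding u_def
    by (intro continuous_on_cases_le continuous_intros \<psi>(1))
       (auto intro!: continuous_intros continuous_on_subset[OF g(1)] simp: g(3) A_def)
  have ratD: "g x \<in> \<rat>" if "u x \<in> \<rat>" for x
  proof -
    have "g x = (if \<psi> x \<le> 0 then 1 - 2 * u x else 2 * u x - 1)" by (simp add: u_def)
    then show ?thesis using that by auto
  qed
  have \<psi>g: "\<psi> x = 0 \<longleftrightarrow> g x = 0" if "x \<in> X" for x using g(3)[OF that] that by (auto simp: A_def)
  show ?thesis
  proof (intro exI[of _ u] conjI ballI)
    fix x assume x: "x \<in> X"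
    show "0 \<le> u x" "u x \<le> 1" using g(2)[OF x] by (auto simp: u_def)
    show "f x \<le> -2 \<longrightarrow> u x < 1/2" "2 \<le> f x \<longrightarrow> 1/2 < u x"
       "u x < 1/2 \<longrightarrow> f x < 1" "1/2 < u x \<longrightarrow> -1 < f x"
      using g(2)[OF x] \<psi>(2)[OF x] \<psi>g[OF x] by (auto simp: u_def abs_le_iff split: if_splits)
  next
    show "u x \<notin> \<rat>" if "x \<in> E" for x using ratD g(4) that by blast
    show "u x \<in> \<rat>" if "x \<in> X - E" for x using g(5)[OF that] by (auto simp: u_def)
  qed (rule uc)
qed

lemma fun_box_neighbourhood:
  fixes V :: "('i::countable \<Rightarrow> real) set"
  assumes "open V" "x \<in> V"
  obtains J a b where "finite J" "\<And>i. a i < x i" "\<And>i. x i < b i"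
    "\<And>y. (\<And>i. i \<in> J \<Longrightarrow> a i < y i \<and> y i < b i) \<Longrightarrow> y \<in> V"
proof -
  have "openin (product_topology (\<lambda>i. euclidean) UNIV) V" using assms by (simp add: euclidean_product_topology)
  then obtain B where B: "x \<in> (\<Pi>\<^sub>E i\<in>UNIV. B i)" "\<And>i. open (B i)" "finite {i. B i \<noteq> UNIV}" "(\<Pi>\<^sub>E i\<in>UNIV. B i) \<subseteq> V"
    using product_topology_open_contains_basis[OF _ assms(2)] by (metis (no_types, lifting) Collect_cong open_openin topspace_euclidean)
  have "\<exists>a b. a < x i \<and> x i < b \<and> {a<..<b} \<subseteq> B i" for i
  proof -
    have "x i \<in> B i" using B(1) by auto
    then obtain e where "0 < e" "ball (x i) e \<subseteq> B i" using B(2) open_contains_ball by metis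
    then show ?thesis by (intro exI[of _ "x i - e"] exI[of _ "x i + e"]) (auto simp: ball_def dist_real_def subset_iff abs_if)
  qed
  then obtain a b where ab: "\<And>i. a i < x i \<and> x i < b i \<and> {a i<..<b i} \<subseteq> B i" by metis
  show ?thesis
  proof (rule that[OF B(3)])
    fix y assume y: "\<And>i. i \<in> {i. B i \<noteq> UNIV} \<Longrightarrow> a i < y i \<and> y i < b i"
    have "y i \<in> B i" for i
      using y[of i] ab[of i] by (cases "B i = UNIV") auto
    then show "y \<in> V" using B(4) by auto
  qed (use ab in auto)
qed

text \<open>Near any point, a bound \<open>a < y k\<close> or \<open>y k < b\<close> follows from
  one strict inequality between a new coordinate and 1/2. Hence the new coordinates determine the
  topology.\<close>

lemma embedding_into_PQ:
  fixes X E :: "(nat \<Rightarrow> real) set"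
  assumes E: "gdelta_in (top_of_set X) E" "zero_dimensional_space (top_of_set E)"
    and F: "zero_dimensional_space (top_of_set (X - E))"
  obtains u :: "(nat \<Rightarrow> real) \<Rightarrow> (nat \<Rightarrow> real)" where "embedding_map (top_of_set X) euclidean u"
    "u ` E \<subseteq> irrational_seqs" "u ` (X - E) \<subseteq> rational_seqs"
proof -
  have EX: "E \<subseteq> X" using gdelta_in_subset[OF E(1)] by simp
  obtain r :: "nat \<Rightarrow> real" where r: "range r = \<rat>"
    using countable_rat uncountable_def by (metis Rats_0 empty_iff)
  \<comment> \<open>A steep function separating the values of the \<open>k\<close>-th coordinate at the rational number \<open>r m\<close>.\<close>
  define f where "f p x = (case p of (k, m, N) \<Rightarrow> real N * (x k - r m))" for p :: "nat \<times> nat \<times> nat" and x :: "nat \<Rightarrow> real"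
  have fc: "continuous_on X (f p)" for p
    unfolding f_def by (cases p) (auto intro!: continuous_intros continuous_on_product_coordinates continuous_on_subset[OF continuous_on_product_coordinates])
  define \<Phi> where "\<Phi> p u \<longleftrightarrow> continuous_on X u \<and> (\<forall>x\<in>X. 0 \<le> u x \<and> u x \<le> 1) \<and>
    (\<forall>x\<in>E. u x \<notin> \<rat>) \<and> (\<forall>x\<in>X - E. u x \<in> \<rat>) \<and>
    (\<forall>x\<in>X. (f p x \<le> -2 \<longrightarrow> u x < 1/2) \<and> (2 \<le> f p x \<longrightarrow> 1/2 < u x) \<and>
       (u x < 1/2 \<longrightarrow> f p x < 1) \<and> (1/2 < u x \<longrightarrow> -1 < f p x))"
    for p and u :: "(nat \<Rightarrow> real) \<Rightarrow> real"
  have "\<exists>u. \<Phi> p u" for p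
    unfolding \<Phi>_def using irrational_rational_separating_function[OF E F fc[of p]] .
  then obtain U where U0: "\<And>p. \<Phi> p (U p)" by metis
  have U: "\<And>p. continuous_on X (U p)" "\<And>p x. x \<in> X \<Longrightarrow> 0 \<le> U p x \<and> U p x \<le> 1"
      "\<And>p x. x \<in> E \<Longrightarrow> U p x \<notin> \<rat>" "\<And>p x. x \<in> X - E \<Longrightarrow> U p x \<in> \<rat>"
    and U2: "\<And>p x. x \<in> X \<Longrightarrow> f p x \<le> -2 \<Longrightarrow> U p x < 1/2" "\<And>p x. x \<in> X \<Longrightarrow> 2 \<le> f p x \<Longrightarrow> 1/2 < U p x"
      "\<And>p x. x \<in> X \<Longrightarrow> U p x < 1/2 \<Longrightarrow> f p x < 1" "\<And>p x. x \<in> X \<Longrightarrow> 1/2 < U p x \<Longrightarrow> -1 < f p x"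
    using U0 unfolding \<Phi>_def by blast+
  define u where "u x n = U (from_nat n) x" for x n
  have ut: "u x (to_nat p) = U p x" for x p by (simp add: u_def)
  have upper: "\<exists>n. u x n < 1/2 \<and> (\<forall>y\<in>X. u y n < 1/2 \<longrightarrow> y k < b)" if x: "x \<in> X" "x k < b" for x k b
  proof -
    obtain q where q: "q \<in> \<rat>" "x k < q" "q < b" using Rats_dense_in_real[OF x(2)] by blast
    then obtain m where m: "r m = q" using r by (metis imageE)
    \<comment> \<open>The slope must carry \<open>x\<close> below -2 and every point with
      \<open>y k \<ge> b\<close> above 1. The sum exceeds each of the two positive
      requirements.\<close>
    obtain N :: nat where N: "real N > 2 / (q - x k) + 1 / (b - q)" using reals_Archimedean2 by blast
    have pos: "0 < 2 / (q - x k)" "0 < 1 / (b - q)" using q by auto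
    have "2 / (q - x k) < real N" "1 / (b - q) < real N" using N pos by linarith+
    then have Nq: "2 < real N * (q - x k)" "1 < real N * (b - q)"
      using q by (simp_all add: pos_divide_less_eq)
    have *: "f (k, m, N) x \<le> -2" "\<And>y. f (k, m, N) y < 1 \<Longrightarrow> y k < b"
    proof -
      show "f (k, m, N) x \<le> -2" using Nq(1) m by (simp add: f_def algebra_simps)
      fix y assume "f (k, m, N) y < 1"
      then have "real N * (y k - q) < real N * (b - q)" using Nq(2) m by (simp add: f_def)
      then show "y k < b" using mult_left_less_imp_less[of "real N" "y k - q" "b - q"] by simp
    qed
    show ?thesis using U2(1)[OF x(1) *(1)] U2(3) *(2) ut by metis
  qed
  have lower: "\<exists>n. 1/2 < u x n \<and> (\<forall>y\<in>X. 1/2 < u y n \<longrightarrow> a < y k)" if x: "x \<in> X" "a < x k" for x k a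
  proof -
    obtain q where q: "q \<in> \<rat>" "a < q" "q < x k" using Rats_dense_in_real[OF x(2)] by blast
    then obtain m where m: "r m = q" using r by (metis imageE)
    obtain N :: nat where N: "real N > 2 / (x k - q) + 1 / (q - a)" using reals_Archimedean2 by blast
    have pos: "0 < 2 / (x k - q)" "0 < 1 / (q - a)" using q by auto
    have "2 / (x k - q) < real N" "1 / (q - a) < real N" using N pos by linarith+
    then have Nq: "2 < real N * (x k - q)" "1 < real N * (q - a)"
      using q by (simp_all add: pos_divide_less_eq)
    have *: "2 \<le> f (k, m, N) x" "\<And>y. -1 < f (k, m, N) y \<Longrightarrow> a < y k"
    proof -
      show "2 \<le> f (k, m, N) x" using Nq(1) m by (simp add: f_def)
      fix y assume "-1 < f (k, m, N) y"
      then have "real N * (a - q) < real N * (y k - q)" using Nq(2) m by (simp add: f_def algebra_simps)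
      then show "a < y k" using mult_left_less_imp_less[of "real N" "a - q" "y k - q"] by simp
    qed
    show ?thesis using U2(2)[OF x(1) *(1)] U2(4) *(2) ut by metis
  qed
  have both: "\<exists>W. open W \<and> u x \<in> W \<and> (\<forall>y\<in>X. u y \<in> W \<longrightarrow> a < y k \<and> y k < b)"
    if x: "x \<in> X" "a < x k" "x k < b" for x k a b
  proof -
    obtain n m where n: "u x n < 1/2" "\<forall>y\<in>X. u y n < 1/2 \<longrightarrow> y k < b"
      and m: "1/2 < u x m" "\<forall>y\<in>X. 1/2 < u y m \<longrightarrow> a < y k"
      using upper[OF x(1,3)] lower[OF x(1,2)] by metis
    have "open {w::nat \<Rightarrow> real. w n < 1/2}" "open {w::nat \<Rightarrow> real. 1/2 < w m}"
      by (intro open_Collect_less continuous_on_product_coordinates continuous_intros)+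
    then have "open ({w::nat \<Rightarrow> real. w n < 1/2} \<inter> {w. 1/2 < w m})" by (rule open_Int)
    then show ?thesis using n m by (intro exI[of _ "{w::nat \<Rightarrow> real. w n < 1/2} \<inter> {w. 1/2 < w m}"]) auto
  qed
  have "embedding_map (top_of_set X) euclidean u"
  proof (rule embedding_map_euclideanI)
    have "continuous_on X u"
      by (rule continuous_on_coordinatewise_then_product) (simp add: u_def U)
    then show "continuous_map (top_of_set X) euclidean u" by simp
    show "t1_space (top_of_set X)"
      by (intro t1_space_subtopology t1_space_euclidean)
    fix V x assume V: "openin (top_of_set X) V" "x \<in> V"
    then obtain O' where O': "open O'" "V = X \<inter> O'" by (metis openin_open)
    then obtain J a b where J: "finite J" "\<And>i. a i < x i" "\<And>i. x i < b i"
      "\<And>y. (\<And>i. i \<in> J \<Longrightarrow> a i < y i \<and> y i < b i) \<Longrightarrow> y \<in> O'"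
      using fun_box_neighbourhood[of O' x] V by blast
    have "x \<in> X" using V O' by auto
    then have "\<forall>i. \<exists>W. open W \<and> u x \<in> W \<and> (\<forall>y\<in>X. u y \<in> W \<longrightarrow> a i < y i \<and> y i < b i)"
      using both[where x = x and k = i and a = "a i" and b = "b i" for i] J(2,3) \<open>x \<in> X\<close> by simp
    then obtain W where W: "\<And>i. open (W i) \<and> u x \<in> W i \<and> (\<forall>y\<in>X. u y \<in> W i \<longrightarrow> a i < y i \<and> y i < b i)"
      by metis
    show "\<exists>W. open W \<and> u x \<in> W \<and> (\<forall>y\<in>topspace (top_of_set X). u y \<in> W \<longrightarrow> y \<in> V)"
    proof (intro exI conjI)
      show "open (\<Inter>i\<in>J. W i)" using J(1) W by auto
      show "u x \<in> (\<Inter>i\<in>J. W i)" using W by auto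
      show "\<forall>y\<in>topspace (top_of_set X). u y \<in> (\<Inter>i\<in>J. W i) \<longrightarrow> y \<in> V"
        using W J(4) O' by auto
    qed
  qed
  moreover have "u ` E \<subseteq> irrational_seqs" "u ` (X - E) \<subseteq> rational_seqs"
  proof -
    have "0 \<le> u x n \<and> u x n \<le> 1" if "x \<in> X" for x n unfolding u_def by (rule U(2)[OF that])
    moreover have "u x n \<notin> \<rat>" if "x \<in> E" for x n unfolding u_def by (rule U(3)[OF that])
    moreover have "u x n \<in> \<rat>" if "x \<in> X - E" for x n unfolding u_def by (rule U(4)[OF that])
    ultimately show "u ` E \<subseteq> irrational_seqs" "u ` (X - E) \<subseteq> rational_seqs"
      using EX by (auto simp: mem_irrational_seqs mem_rational_seqs)
  qed
  ultimately show ?thesis using that by blast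
qed

subsection \<open>Borel classes of embedded copies\<close>

lemma fsigma_in_continuous_map_preimage:
  assumes f: "continuous_map X Y f" and S: "fsigma_in Y S"
  shows "fsigma_in X {x \<in> topspace X. f x \<in> S}"
proof -
  obtain C :: "nat \<Rightarrow> _" where C: "\<And>n. closedin Y (C n)" "\<And>n. C n \<subseteq> C (Suc n)" "\<Union>(range C) = S"
    using S unfolding fsigma_in_ascending by blast
  show ?thesis
    unfolding fsigma_in_ascending
  proof (intro exI conjI allI)
    show "closedin X {x \<in> topspace X. f x \<in> C n}" for n
      using closedin_continuous_map_preimage[OF f C(1)] .
    show "{x \<in> topspace X. f x \<in> C n} \<subseteq> {x \<in> topspace X. f x \<in> C (Suc n)}" for n using C(2) by auto
    show "(\<Union>n. {x \<in> topspace X. f x \<in> C n}) = {x \<in> topspace X. f x \<in> S}" using C(3) by auto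
  qed
qed

text \<open>Complete metrizability carries the property over: it holds for \<open>G_delta\<close>
  subspaces of completely metrizable spaces, is preserved by homeomorphisms, and forces a subspace
  of any metrizable space to be a \<open>G_delta\<close> set.\<close>

lemma absolutely_gdelta_imp_gdelta_in:
  assumes Y: "absolutely_gdelta TYPE('b) Y" and X: "metrizable_space X" and h: "embedding_map Y X h"
  shows "gdelta_in X (h ` topspace Y)"
proof -
  obtain Z :: "'b topology" and e where Z: "completely_metrizable_space Z" "embedding_map Y Z e" "gdelta_in Z (e ` topspace Y)"
    using Y unfolding absolutely_gdelta_def by blast
  have "completely_metrizable_space (subtopology Z (e ` topspace Y))"
    using Z(1,3) by (rule completely_metrizable_space_gdelta_in)
  then have "completely_metrizable_space (subtopology X (h ` topspace Y))"
    using homeomorphic_completely_metrizable_space[OF embedding_map_imp_homeomorphic_space[OF Z(2)]]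
      homeomorphic_completely_metrizable_space[OF embedding_map_imp_homeomorphic_space[OF h]] by simp
  moreover have "h ` topspace Y \<subseteq> topspace X"
    using h by (metis embedding_map_def homeomorphic_imp_surjective_map inf_le1 topspace_subtopology)
  ultimately show ?thesis using completely_metrizable_space_imp_gdelta_in[OF X] by blast
qed

text \<open>By Lavrentiev's theorem, the homeomorphism between two copies of \<open>Y\<close> extends to a
  continuous map \<open>g\<close> on a \<open>G\<^sub>\<delta>\<close> set \<open>U\<close> in which the first copy is dense; the first copy is then
  the full preimage of the second.\<close>

lemma absolutely_fsigma_delta_imp_Inter:
  assumes Y: "absolutely_fsigma_delta TYPE('c) Y" and X: "metrizable_space X" and h: "embedding_map Y X h"
  obtains \<S> where "countable \<S>" "\<And>S. S \<in> \<S> \<Longrightarrow> fsigma_in X S" "h ` topspace Y = topspace X \<inter> \<Inter>\<S>"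
proof -
  obtain Z :: "'c topology" and e where Z: "completely_metrizable_space Z" "embedding_map Y Z e" "fsigma_delta_in Z (e ` topspace Y)"
    using Y unfolding absolutely_fsigma_delta_def by blast
  define D W where "D = h ` topspace Y" and "W = e ` topspace Y"
  obtain k where k: "homeomorphic_maps Y (subtopology X D) h k"
    using h unfolding embedding_map_def D_def homeomorphic_map_maps by blast
  obtain l where l: "homeomorphic_maps Y (subtopology Z W) e l"
    using Z(2) unfolding embedding_map_def W_def homeomorphic_map_maps by blast
  have DX: "D \<subseteq> topspace X"
    using h unfolding D_def by (metis embedding_map_def homeomorphic_imp_surjective_map inf_le1 topspace_subtopology)
  have WZ: "W \<subseteq> topspace Z"
    using Z(2) unfolding W_def by (metis embedding_map_def homeomorphic_imp_surjective_map inf_le1 topspace_subtopology)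
  have ek: "continuous_map (subtopology X D) (subtopology Z W) (e \<circ> k)"
    using k l unfolding homeomorphic_maps_def by (meson continuous_map_compose)
  have hl: "continuous_map (subtopology Z W) (subtopology X D) (h \<circ> l)"
    using k l unfolding homeomorphic_maps_def by (meson continuous_map_compose)
  have inv: "(h \<circ> l) ((e \<circ> k) x) = x" if "x \<in> D" for x
    using k l that DX unfolding homeomorphic_maps_def by (auto simp: D_def)
  have ekZ: "continuous_map (subtopology X D) Z (e \<circ> k)" using ek continuous_map_in_subtopology by blast
  obtain U g where U: "gdelta_in X U" "D \<subseteq> U" "U \<subseteq> X closure_of D"
    and g: "continuous_map (subtopology X U) Z g" "\<And>x. x \<in> D \<Longrightarrow> g x = (e \<circ> k) x"
    using Lavrentiev_extension[OF DX _ Z(1) ekZ] X by metis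
  have UX: "U \<subseteq> topspace X" using U(1) gdelta_in_subset by blast
  have D_eq: "D = {x \<in> U. g x \<in> W}"
  proof (intro set_eqI iffI)
    fix x assume x: "x \<in> D"
    then have "(e \<circ> k) x \<in> W" using ek DX by (auto simp: continuous_map_def Pi_iff)
    then show "x \<in> {x \<in> U. g x \<in> W}" using x U(2) g(2) by auto
  next
    fix x assume x: "x \<in> {x \<in> U. g x \<in> W}"
    \<comment> \<open>On \<open>U'\<close> the map \<open>g\<close> can be followed by the
      homeomorphism back to \<open>D\<close>. The composition agrees with the identity on
      \<open>D\<close>, which is dense in \<open>U'\<close>, so it fixes \<open>x\<close> and puts
      \<open>x\<close> into \<open>D\<close>.\<close>
    define U' where "U' = {x \<in> U. g x \<in> W}"
    have "g y \<in> W" if "y \<in> D" for y using that ek DX g(2) by (auto simp: continuous_map_def Pi_iff)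
    then have DU': "D \<subseteq> U'" using U(2) unfolding U'_def by auto
    have U'X: "U' \<subseteq> topspace X" using UX unfolding U'_def by auto
    have "continuous_map (subtopology X U') (subtopology Z W) g"
      using g(1) continuous_map_from_subtopology_mono[of X U Z g U'] unfolding U'_def
      by (auto simp: continuous_map_in_subtopology)
    then have "continuous_map (subtopology X U') X ((h \<circ> l) \<circ> g)"
      using hl continuous_map_compose continuous_map_in_subtopology by blast
    moreover have "continuous_map (subtopology X U') X id" by (simp add: continuous_map_from_subtopology)
    moreover have "x \<in> subtopology X U' closure_of D"
      using x U(3) DU' unfolding closure_of_subtopology U'_def by (auto simp: Int_absorb1)
    moreover have "Hausdorff_space X" using X metrizable_imp_Hausdorff_space by blast
    ultimately have "((h \<circ> l) \<circ> g) x = id x"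
      using forall_in_closure_of_eq[of x "subtopology X U'" D X "(h \<circ> l) \<circ> g" id] inv g(2) by force
    moreover have "(h \<circ> l) (g x) \<in> D"
      using hl x WZ DX unfolding continuous_map_def Pi_iff by auto
    ultimately show "x \<in> D" by simp
  qed
  obtain \<T> where T: "countable \<T>" "\<And>T. T \<in> \<T> \<Longrightarrow> fsigma_in Z T" "W = topspace Z \<inter> \<Inter>\<T>"
  proof -
    have "\<exists>\<T>. countable \<T> \<and> \<T> \<subseteq> Collect (fsigma_in Z) \<and> topspace Z \<inter> \<Inter>\<T> = W"
      using Z(3) unfolding fsigma_delta_in_def relative_to_def intersection_of_def W_def by auto
    then show ?thesis using that by blast
  qed
  obtain \<U> where Us: "countable \<U>" "\<And>V. V \<in> \<U> \<Longrightarrow> openin X V" "U = \<Inter>\<U>"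
    using U(1) unfolding gdelta_in_alt intersection_of_def by auto
  \<comment> \<open>Preimages under \<open>g\<close> are \<open>F_sigma\<close> only relative to
    \<open>U\<close>, so they are written as traces. The set \<open>U\<close> is restored by adding
    its open supersets from \<open>\<U>\<close>, which are \<open>F_sigma\<close> in a metrizable
    space.\<close>
  have "\<exists>S. fsigma_in X S \<and> {x \<in> U. g x \<in> T} = S \<inter> U" if "T \<in> \<T>" for T
  proof -
    have "fsigma_in (subtopology X U) {x \<in> topspace (subtopology X U). g x \<in> T}"
      using g(1) T(2)[OF that] by (rule fsigma_in_continuous_map_preimage)
    moreover have "topspace (subtopology X U) = U" using UX by auto
    ultimately have "fsigma_in (subtopology X U) {x \<in> U. g x \<in> T}" by metis
    then show ?thesis unfolding fsigma_in_subtopology .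
  qed
  then obtain s where s: "\<And>T. T \<in> \<T> \<Longrightarrow> fsigma_in X (s T) \<and> {x \<in> U. g x \<in> T} = s T \<inter> U" by metis
  show ?thesis
  proof
    show "countable (\<U> \<union> s ` \<T>)" using Us(1) T(1) by auto
    show "fsigma_in X S" if "S \<in> \<U> \<union> s ` \<T>" for S
      using that s Us(2) open_imp_fsigma_in[OF X] by auto
    have gZ: "g x \<in> topspace Z" if "x \<in> U" for x
      using g(1) that UX by (auto simp: continuous_map_def Pi_iff)
    have "D = {x \<in> U. \<forall>T\<in>\<T>. g x \<in> T}" unfolding D_eq T(3) using gZ by auto
    also have "\<dots> = {x \<in> U. \<forall>T\<in>\<T>. x \<in> s T}" using s by blast
    also have "\<dots> = topspace X \<inter> \<Inter>(\<U> \<union> s ` \<T>)" using UX Us(3) by auto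
    finally show "h ` topspace Y = topspace X \<inter> \<Inter>(\<U> \<union> s ` \<T>)" unfolding D_def .
  qed
qed

text \<open>A box with its faces at values outside \<open>D\<close> has no point of \<open>S\<close>
  on its boundary, so its trace on \<open>S\<close> is clopen. Both the irrational and the rational
  sequences are of this kind.\<close>

lemma zero_dimensional_space_product_dense_complement:
  fixes D :: "real set"
  assumes D: "\<And>a b. a < b \<Longrightarrow> \<exists>c. a < c \<and> c < b \<and> c \<notin> D" and S: "S \<subseteq> {x::nat \<Rightarrow> real. \<forall>n. x n \<in> D}"
  shows "zero_dimensional_space (top_of_set S)"
proof (rule zero_dimensional_space_clopenI)
  fix x V assume V: "openin (top_of_set S) V" "x \<in> V"
  then obtain G where G: "open G" "V = S \<inter> G" by (metis openin_open)
  then obtain J a b where J: "finite J" "\<And>i. a i < x i" "\<And>i. x i < b i"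
      "\<And>y. (\<And>i. i \<in> J \<Longrightarrow> a i < y i \<and> y i < b i) \<Longrightarrow> y \<in> G"
    using fun_box_neighbourhood[of G x] V by blast
  have "\<exists>c. a i < c \<and> c < x i \<and> c \<notin> D" "\<exists>c. x i < c \<and> c < b i \<and> c \<notin> D" for i
    using D[OF J(2)[of i]] D[OF J(3)[of i]] by auto
  then obtain a' b' where a': "\<And>i. a i < a' i \<and> a' i < x i \<and> a' i \<notin> D" and b': "\<And>i. x i < b' i \<and> b' i < b i \<and> b' i \<notin> D"
    by metis
  define B where "B = (\<Inter>i\<in>J. {y::nat \<Rightarrow> real. a' i < y i} \<inter> {y. y i < b' i})"
  define C where "C = (\<Union>i\<in>J. {y::nat \<Rightarrow> real. y i < a' i} \<union> {y. b' i < y i})"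
  have op: "open {y::nat \<Rightarrow> real. c < y i}" "open {y::nat \<Rightarrow> real. y i < c}" for i c
    by (intro open_Collect_less continuous_on_product_coordinates continuous_intros)+
  have "open B" "open C" unfolding B_def C_def using op J(1) by (auto intro!: open_INT open_UN open_Int open_Un)
  moreover have "S - S \<inter> B = S \<inter> C"
  proof -
    have "y i \<noteq> a' i \<and> y i \<noteq> b' i" if "y \<in> S" for y i
    proof -
      have "y i \<in> D" using that S by auto
      then show ?thesis using a'[of i] b'[of i] by metis
    qed
    then have "a' i < y i \<and> y i < b' i \<longleftrightarrow> \<not> (y i < a' i \<or> b' i < y i)" if "y \<in> S" for y i
      using that by (metis less_asym linorder_neqE)
    then have "y \<in> B \<longleftrightarrow> y \<notin> C" if "y \<in> S" for y
      using that unfolding B_def C_def by simp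
    then show ?thesis by blast
  qed
  moreover have "x \<in> S \<inter> B" using V G a' b' unfolding B_def by auto
  moreover have "S \<inter> B \<subseteq> V"
  proof
    fix y assume y: "y \<in> S \<inter> B"
    have "y \<in> G"
    proof (rule J(4))
      fix i assume "i \<in> J"
      then have "a' i < y i" "y i < b' i" using y unfolding B_def by auto
      then show "a i < y i \<and> y i < b i" using a'[of i] b'[of i] by linarith
    qed
    then show "y \<in> V" using y G by auto
  qed
  ultimately show "\<exists>U. openin (top_of_set S) U \<and> openin (top_of_set S) (S - U) \<and> x \<in> U \<and> U \<subseteq> V"
    by (metis openin_open_Int)
qed

lemma zero_dimensional_irrational_seqs: "zero_dimensional_space (top_of_set irrational_seqs)"
proof (rule zero_dimensional_space_product_dense_complement)
  show "\<exists>c. a < c \<and> c < b \<and> c \<notin> - \<rat>" if "a < b" for a b :: real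
    using Rats_dense_in_real[OF that] by auto
qed (auto simp: mem_irrational_seqs)

lemma zero_dimensional_rational_seqs: "zero_dimensional_space (top_of_set rational_seqs)"
proof (rule zero_dimensional_space_product_dense_complement)
  show "\<exists>c. a < c \<and> c < b \<and> c \<notin> \<rat>" if "a < b" for a b :: real
  proof -
    have "uncountable {a<..<b}" using that by (simp add: uncountable_open_interval)
    then have "\<not> {a<..<b} \<subseteq> \<rat>" using countable_rat countable_subset by blast
    then show ?thesis by auto
  qed
qed (auto simp: mem_rational_seqs)

subsection \<open>Adding coordinates to close the image\<close>

lemma closed_embedding_of_union:
  fixes E F :: "(nat \<Rightarrow> real) set"
  defines "Y \<equiv> irrational_seqs \<union> rational_seqs"
  assumes E: "E \<subseteq> irrational_seqs" "gdelta_in (top_of_set Y) E"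
    and F: "F \<subseteq> rational_seqs" "countable \<S>" "\<And>S. S \<in> \<S> \<Longrightarrow> fsigma_in euclidean S" "F = \<Inter>\<S>"
  obtains \<Psi> :: "(nat \<Rightarrow> real) \<Rightarrow> (nat \<Rightarrow> real)" where "embedding_map (top_of_set Y) euclidean \<Psi>"
    "\<And>y. y \<in> Y \<Longrightarrow> \<Psi> y \<in> irrational_seqs \<longleftrightarrow> y \<in> E" "\<And>y. y \<in> Y \<Longrightarrow> \<Psi> y \<in> rational_seqs \<longleftrightarrow> y \<in> F"
    "closedin (top_of_set Y) (\<Psi> ` (E \<union> F))"
proof -
  have disj: "irrational_seqs \<inter> rational_seqs = {}" by (auto simp: mem_irrational_seqs mem_rational_seqs)
  have mY: "metrizable_space (top_of_set Y)" by (simp add: metrizable_space_subtopology metrizable_space_euclidean)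
  obtain r :: "nat \<Rightarrow> real" where r: "range r = \<rat>"
    using countable_rat uncountable_def by (metis Rats_0 empty_iff)
  \<comment> \<open>In \<open>Y\<close> a single rational coordinate already forces a rational
    sequence. Hence these countably many closed sets make up \<open>rational_seqs\<close>, and
    \<open>irrational_seqs\<close> is a \<open>G_delta\<close> set in \<open>Y\<close>.\<close>
  define K where "K j = {y \<in> Y. y 0 = r j}" for j
  have K: "closedin (top_of_set Y) (K j)" for j
    unfolding K_def by (rule continuous_closedin_preimage_constant)
      (rule continuous_on_subset[OF continuous_on_product_coordinates], simp)
  have Kirr: "K j \<inter> irrational_seqs = {}" for j
  proof -
    have "r j \<in> \<rat>" using r by auto
    then have "y \<notin> irrational_seqs" if "y 0 = r j" for y
      using that unfolding mem_irrational_seqs by metis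
    then show ?thesis by (auto simp: K_def)
  qed
  have UnK: "rational_seqs = (\<Union>j. K j)"
  proof (intro set_eqI iffI)
    fix y assume y: "y \<in> rational_seqs"
    then have "y 0 \<in> range r" unfolding r by (auto simp: mem_rational_seqs)
    then show "y \<in> (\<Union>j. K j)" using y by (auto simp: K_def Y_def)
  next
    fix y assume "y \<in> (\<Union>j. K j)"
    then show "y \<in> rational_seqs" using Kirr by (auto simp: K_def Y_def)
  qed
  have "fsigma_in (top_of_set Y) rational_seqs"
    unfolding UnK by (rule fsigma_in_Union) (auto intro: closed_imp_fsigma_in K)
  then have "gdelta_in (top_of_set Y) (Y - rational_seqs)"
    using gdelta_in_diff[OF gdelta_in_topspace, of "top_of_set Y"] by simp
  moreover have "Y - rational_seqs = irrational_seqs" using disj by (auto simp: Y_def)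
  ultimately have Pg: "gdelta_in (top_of_set Y) irrational_seqs" by simp

  have "fsigma_in (top_of_set Y) (Y - E)"
    using E(2) gdelta_in_fsigma_in[of "top_of_set Y" E] by simp
  then obtain C :: "nat \<Rightarrow> _" where C: "\<And>n. closedin (top_of_set Y) (C n)" "\<Union>(range C) = Y - E"
    unfolding fsigma_in_ascending by blast
  \<comment> \<open>\<open>v n\<close> turns rational on the part \<open>C n\<close> of \<open>Y - E\<close>, where all of the original coordinates may be
    irrational.\<close>
  have "\<exists>v::(nat \<Rightarrow> real) \<Rightarrow> real. continuous_on Y v \<and> (\<forall>y\<in>Y. 0 \<le> v y \<and> v y \<le> 1) \<and>
     (\<forall>y\<in>Y. v y \<in> \<rat> \<longleftrightarrow> y \<in> rational_seqs \<union> C n)" for n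
  proof -
    let ?E = "irrational_seqs - C n"
    have "gdelta_in (top_of_set Y) ?E"
      by (rule gdelta_in_diff[OF Pg closed_imp_fsigma_in[OF C(1)]])
    moreover have "?E \<inter> C n = {}" by auto
    moreover have "zero_dimensional_space (top_of_set ?E)"
      by (rule zero_dimensional_space_subset[OF zero_dimensional_irrational_seqs]) auto
    moreover have "zero_dimensional_space (top_of_set (Y - C n - ?E))"
      by (rule zero_dimensional_space_subset[OF zero_dimensional_rational_seqs]) (auto simp: Y_def)
    ultimately obtain v :: "(nat \<Rightarrow> real) \<Rightarrow> real" where "continuous_on Y v" "\<And>x. x \<in> Y \<Longrightarrow> 0 \<le> v x \<and> v x \<le> 1"
      "\<And>x. x \<in> ?E \<Longrightarrow> v x \<notin> \<rat>" "\<And>x. x \<in> Y - ?E \<Longrightarrow> v x \<in> \<rat>"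
      using irrational_rational_function[OF C(1)] by metis
    then show ?thesis using disj by (intro exI[of _ v]) (auto simp: Y_def)
  qed
  then obtain v :: "nat \<Rightarrow> (nat \<Rightarrow> real) \<Rightarrow> real" where
    v: "\<And>n. continuous_on Y (v n)" "\<And>n y. y \<in> Y \<Longrightarrow> 0 \<le> v n y \<and> v n y \<le> 1"
      "\<And>n y. y \<in> Y \<Longrightarrow> v n y \<in> \<rat> \<longleftrightarrow> y \<in> rational_seqs \<union> C n"
    by metis

  \<comment> \<open>Inserting \<open>UNIV\<close> makes the family nonempty, as the enumeration
    requires, without changing its intersection.\<close>
  define S where "S = from_nat_into (insert UNIV \<S>)"
  have rS: "range S = insert UNIV \<S>" unfolding S_def using F(2) by (simp add: range_from_nat_into)
  then have Sf: "fsigma_in euclidean (S n)" for n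
    using F(3) fsigma_in_topspace[of euclidean] by (metis insertE rangeI topspace_euclidean)
  have FS: "F = (\<Inter>n. S n)" using rS F(4) by auto
  have Gg: "gdelta_in (top_of_set Y) (Y - S n)" for n
  proof -
    have "fsigma_in (top_of_set Y) (S n \<inter> Y)" using Sf fsigma_in_subtopology by blast
    then have "gdelta_in (top_of_set Y) (Y - (S n \<inter> Y))"
      using gdelta_in_diff[OF gdelta_in_topspace, of "top_of_set Y"] by simp
    then show ?thesis by (simp add: Diff_Int)
  qed
  \<comment> \<open>Cutting \<open>Y - S m\<close> with \<open>K j\<close> makes it relatively closed in its union with the irrational sequences,
    which is therefore zero-dimensional.\<close>
  have "\<exists>w::(nat \<Rightarrow> real) \<Rightarrow> real. continuous_on Y w \<and> (\<forall>y\<in>Y. 0 \<le> w y \<and> w y \<le> 1) \<and>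
     (\<forall>y\<in>Y. w y \<in> \<rat> \<longleftrightarrow> y \<in> rational_seqs \<and> \<not> (y \<notin> S m \<and> y 0 = r j))" for m j
  proof -
    let ?G = "(Y - S m) \<inter> K j"
    let ?E = "irrational_seqs \<union> ?G"
    have GQ: "?G \<subseteq> rational_seqs" using UnK by auto
    have "gdelta_in (top_of_set Y) ?E"
      by (intro gdelta_in_Un gdelta_in_Int Pg Gg closed_imp_gdelta_in mY K)
    moreover have "zero_dimensional_space (top_of_set ?E)"
    proof (rule zero_dimensional_Un_closed[OF zero_dimensional_irrational_seqs])
      show "zero_dimensional_space (top_of_set ?G)"
        using zero_dimensional_rational_seqs GQ by (rule zero_dimensional_space_subset)
      obtain T where T: "closed T" "K j = Y \<inter> T" using K by (auto simp: closedin_closed)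
      have "?G = ?E \<inter> T" using T(2) Kirr[of j] by (auto simp: Y_def)
      then show "closedin (top_of_set ?E) ?G" using T(1) closedin_closed by blast
    qed
    moreover have "zero_dimensional_space (top_of_set (Y - {} - ?E))"
      by (rule zero_dimensional_space_subset[OF zero_dimensional_rational_seqs]) (auto simp: Y_def)
    ultimately obtain w :: "(nat \<Rightarrow> real) \<Rightarrow> real" where w: "continuous_on Y w" "\<And>x. x \<in> Y \<Longrightarrow> 0 \<le> w x \<and> w x \<le> 1"
      "\<And>x. x \<in> ?E \<Longrightarrow> w x \<notin> \<rat>" "\<And>x. x \<in> Y - ?E \<Longrightarrow> w x \<in> \<rat>"
      using irrational_rational_function[OF closedin_empty, of Y ?E] by (metis Int_empty_right)
    have "w y \<in> \<rat> \<longleftrightarrow> y \<in> rational_seqs \<and> \<not> (y \<notin> S m \<and> y 0 = r j)" if "y \<in> Y" for y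
    proof -
      have "y \<in> ?E \<longleftrightarrow> y \<notin> rational_seqs \<or> (y \<notin> S m \<and> y 0 = r j)"
        using that disj unfolding Y_def K_def by auto
      then show ?thesis using w(3,4) that by blast
    qed
    then show ?thesis using w(1,2) by blast
  qed
  then obtain w :: "nat \<Rightarrow> nat \<Rightarrow> (nat \<Rightarrow> real) \<Rightarrow> real" where
    w: "\<And>m j. continuous_on Y (w m j)" "\<And>m j y. y \<in> Y \<Longrightarrow> 0 \<le> w m j y \<and> w m j y \<le> 1"
      "\<And>m j y. y \<in> Y \<Longrightarrow> w m j y \<in> \<rat> \<longleftrightarrow> y \<in> rational_seqs \<and> \<not> (y \<notin> S m \<and> y 0 = r j)"
    by metis

  \<comment> \<open>The original coordinates are kept next to the new ones, so \<open>\<pi>\<close>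
    recovers \<open>y\<close> from \<open>\<Psi> y\<close>.\<close>
  define coord :: "nat + nat + nat \<times> nat \<Rightarrow> (nat \<Rightarrow> real) \<Rightarrow> real" where
    "coord i y = (case i of Inl k \<Rightarrow> y k | Inr (Inl n) \<Rightarrow> v n y | Inr (Inr (m, j)) \<Rightarrow> w m j y)" for i y
  define \<Psi> where "\<Psi> y k = coord (from_nat k) y" for y k
  define \<pi> :: "(nat \<Rightarrow> real) \<Rightarrow> (nat \<Rightarrow> real)" where "\<pi> z k = z (to_nat (Inl k :: nat + nat + nat \<times> nat))" for z k
  have all: "(\<forall>k. Q (\<Psi> y k)) \<longleftrightarrow> (\<forall>k. Q (y k)) \<and> (\<forall>n. Q (v n y)) \<and> (\<forall>m j. Q (w m j y))" for Q y
  proof -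
    have "(\<forall>k. Q (\<Psi> y k)) \<longleftrightarrow> (\<forall>i. Q (coord i y))" unfolding \<Psi>_def by (metis from_nat_to_nat)
    also have "\<dots> \<longleftrightarrow> (\<forall>k. Q (y k)) \<and> (\<forall>n. Q (v n y)) \<and> (\<forall>m j. Q (w m j y))"
      by (auto simp: coord_def split: sum.splits prod.splits)
    finally show ?thesis .
  qed
  have \<pi>\<Psi>: "\<pi> (\<Psi> y) = y" for y by (auto simp: \<pi>_def \<Psi>_def coord_def)
  have \<pi>c: "continuous_on UNIV \<pi>" unfolding \<pi>_def
    by (intro continuous_on_coordinatewise_then_product continuous_on_product_coordinates)
  have coordc: "continuous_on Y (coord i)" for i
  proof -
    consider k where "i = Inl k" | n where "i = Inr (Inl n)" | m j where "i = Inr (Inr (m, j))"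
      by (metis old.sum.exhaust surj_pair)
    then show ?thesis
    proof cases
      case (1 k)
      then have "coord i = (\<lambda>y. y k)" by (auto simp: coord_def)
      then show ?thesis by (metis continuous_on_product_coordinates continuous_on_subset subset_UNIV)
    next
      case (2 n)
      then have "coord i = v n" by (auto simp: coord_def)
      then show ?thesis using v(1) by simp
    next
      case (3 m j)
      then have "coord i = w m j" by (auto simp: coord_def)
      then show ?thesis using w(1) by simp
    qed
  qed
  have \<Psi>c: "continuous_on Y \<Psi>" unfolding \<Psi>_def
    by (rule continuous_on_coordinatewise_then_product) (rule coordc)
  have emb: "embedding_map (top_of_set Y) euclidean \<Psi>"
    unfolding embedding_map_def homeomorphic_map_maps
  proof (intro exI[of _ \<pi>])
    show "homeomorphic_maps (top_of_set Y) (top_of_set (\<Psi> ` topspace (top_of_set Y))) \<Psi> \<pi>"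
      using \<Psi>c continuous_on_subset[OF \<pi>c, of "\<Psi> ` Y"]
      by (auto simp: homeomorphic_maps_def continuous_map_in_subtopology \<pi>\<Psi>)
  qed
  have Y01: "0 \<le> y k \<and> y k \<le> 1" if "y \<in> Y" for y k
    using that by (auto simp: Y_def mem_irrational_seqs mem_rational_seqs)
  have \<Psi>01: "0 \<le> \<Psi> y k \<and> \<Psi> y k \<le> 1" if "y \<in> Y" for y k
    using all[of "\<lambda>t. 0 \<le> t \<and> t \<le> 1" y] Y01[OF that] v(2)[OF that] w(2)[OF that] by blast
  have irr: "\<Psi> y \<in> irrational_seqs \<longleftrightarrow> y \<in> E" if y: "y \<in> Y" for y
  proof -
    have "\<Psi> y \<in> irrational_seqs \<longleftrightarrow> (\<forall>k. \<Psi> y k \<notin> \<rat>)" using \<Psi>01[OF y] by (simp add: mem_irrational_seqs)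
    also have "\<dots> \<longleftrightarrow> (\<forall>k. y k \<notin> \<rat>) \<and> (\<forall>n. v n y \<notin> \<rat>) \<and> (\<forall>m j. w m j y \<notin> \<rat>)" by (rule all)
    \<comment> \<open>On irrational sequences every \<open>w m j\<close> is irrational anyway, so
      only the coordinates \<open>v n\<close> impose a condition.\<close>
    also have "\<dots> \<longleftrightarrow> y \<in> irrational_seqs \<and> (\<forall>n. y \<notin> C n)"
      using v(3)[OF y] w(3)[OF y] disj Y01[OF y] by (auto simp: mem_irrational_seqs mem_rational_seqs)
    also have "\<dots> \<longleftrightarrow> y \<in> E" using C(2) y E(1) by blast
    finally show ?thesis .
  qed
  have rat: "\<Psi> y \<in> rational_seqs \<longleftrightarrow> y \<in> F" if y: "y \<in> Y" for y
  proof -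
    have "\<Psi> y \<in> rational_seqs \<longleftrightarrow> (\<forall>k. \<Psi> y k \<in> \<rat>)" using \<Psi>01[OF y] by (simp add: mem_rational_seqs)
    also have "\<dots> \<longleftrightarrow> (\<forall>k. y k \<in> \<rat>) \<and> (\<forall>n. v n y \<in> \<rat>) \<and> (\<forall>m j. w m j y \<in> \<rat>)" by (rule all)
    also have "\<dots> \<longleftrightarrow> y \<in> rational_seqs \<and> (\<forall>m j. \<not> (y \<notin> S m \<and> y 0 = r j))"
      using v(3)[OF y] w(3)[OF y] Y01[OF y] by (auto simp: mem_rational_seqs)
    \<comment> \<open>For a rational sequence some \<open>j\<close> has \<open>y 0 = r j\<close>, so
      the cut by \<open>K j\<close> loses nothing once all \<open>j\<close> are considered.\<close>
    also have "\<dots> \<longleftrightarrow> y \<in> rational_seqs \<and> (\<forall>m. y \<in> S m)"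
      using UnK unfolding K_def by blast
    also have "\<dots> \<longleftrightarrow> y \<in> F" using FS F(1) by blast
    finally show ?thesis .
  qed
  have EFY: "E \<union> F \<subseteq> Y" using E(1) F(1) by (auto simp: Y_def)
  have \<pi>Y: "\<pi> z \<in> Y" if "z \<in> Y" for z
    using that by (auto simp: Y_def \<pi>_def mem_irrational_seqs mem_rational_seqs)
  \<comment> \<open>The image is closed as the fixed point set of \<open>\<Psi> \<circ> \<pi>\<close>, because \<open>\<pi>\<close> is a left inverse of \<open>\<Psi>\<close>
    defined on all of \<open>Y\<close>.\<close>
  have "continuous_on Y (\<Psi> \<circ> \<pi>)"
    by (intro continuous_on_compose continuous_on_subset[OF \<pi>c] continuous_on_subset[OF \<Psi>c]) (use \<pi>Y in auto)
  then have "closedin (top_of_set Y) {z \<in> topspace (top_of_set Y). (\<Psi> \<circ> \<pi>) z = id z}"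
    by (intro closedin_continuous_maps_eq[where Y = euclidean]) (auto simp: Hausdorff_space_euclidean)
  moreover have "{z \<in> topspace (top_of_set Y). (\<Psi> \<circ> \<pi>) z = id z} = \<Psi> ` (E \<union> F)"
  proof (intro set_eqI iffI)
    fix z assume z: "z \<in> {z \<in> topspace (top_of_set Y). (\<Psi> \<circ> \<pi>) z = id z}"
    then have "\<pi> z \<in> Y" "\<Psi> (\<pi> z) = z" "z \<in> irrational_seqs \<union> rational_seqs" using \<pi>Y by (auto simp: Y_def)
    then show "z \<in> \<Psi> ` (E \<union> F)" using irr[of "\<pi> z"] rat[of "\<pi> z"] by (metis Un_iff image_eqI)
  next
    fix z assume "z \<in> \<Psi> ` (E \<union> F)"
    then obtain y where y: "y \<in> E \<union> F" "z = \<Psi> y" by auto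
    then have "z \<in> Y" using irr[of y] rat[of y] EFY unfolding Y_def by blast
    then show "z \<in> {z \<in> topspace (top_of_set Y). (\<Psi> \<circ> \<pi>) z = id z}" using y \<pi>\<Psi> by simp
  qed
  ultimately have cl: "closedin (top_of_set Y) (\<Psi> ` (E \<union> F))" by simp
  show ?thesis by (rule that[OF emb irr rat cl])
qed

section \<open>Transfer along embeddings and assembly of the embedding\<close>

lemma embedding_map_from_subtopology:
  assumes "embedding_map X Z h"
  shows "embedding_map (subtopology X S) Z h"
proof -
  have h: "homeomorphic_map X (subtopology Z (h ` topspace X)) h" using assms by (simp add: embedding_map_def)
  then have "h ` topspace X \<subseteq> topspace Z" by (metis homeomorphic_imp_surjective_map inf_le1 topspace_subtopology)
  then have "homeomorphic_map (subtopology X S) (subtopology (subtopology Z (h ` topspace X)) (h ` (topspace X \<inter> S))) h"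
    by (intro homeomorphic_map_subtopologies[OF h]) auto
  moreover have "h ` topspace X \<inter> h ` (topspace X \<inter> S) = h ` (topspace X \<inter> S)" by auto
  ultimately show ?thesis by (simp add: embedding_map_def subtopology_subtopology)
qed

lemma zero_dimensional_space_homeomorphic_map:
  assumes f: "homeomorphic_map Y Z f" and Y: "zero_dimensional_space Y"
  shows "zero_dimensional_space Z"
  unfolding zero_dimensional_space_def dimension_le_0_neighbourhood_base_of_clopen
proof (subst open_neighbourhood_base_of, simp, intro allI impI, elim conjE)
  fix W z assume W: "openin Z W" "z \<in> W"
  have "z \<in> f ` topspace Y" using W openin_subset homeomorphic_imp_surjective_map[OF f] by blast
  then obtain y where y: "y \<in> topspace Y" "z = f y" by auto
  have "openin Y {y \<in> topspace Y. f y \<in> W}"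
    using openin_continuous_map_preimage[OF homeomorphic_imp_continuous_map[OF f] W(1)] .
  moreover have "neighbourhood_base_of (\<lambda>U. closedin Y U \<and> openin Y U) Y"
    using Y unfolding zero_dimensional_space_def dimension_le_0_neighbourhood_base_of_clopen .
  then have "\<forall>V x. openin Y V \<and> x \<in> V \<longrightarrow> (\<exists>U. (closedin Y U \<and> openin Y U) \<and> x \<in> U \<and> U \<subseteq> V)"
    by (subst (asm) open_neighbourhood_base_of) auto
  ultimately obtain U where U: "closedin Y U" "openin Y U" "y \<in> U" "U \<subseteq> {y \<in> topspace Y. f y \<in> W}"
    using y W(2) by (metis (no_types, lifting) mem_Collect_eq)
  have "U \<subseteq> topspace Y" using U by auto
  then have "closedin Z (f ` U)" "openin Z (f ` U)"
    using U homeomorphic_map_closedness[OF f] homeomorphic_map_openness[OF f] by auto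
  then show "\<exists>U. (closedin Z U \<and> openin Z U) \<and> z \<in> U \<and> U \<subseteq> W" using U y by blast
qed

theorem theorem1p2:
  fixes X :: "'a topology" and E F :: "'a set"
  assumes "separable_space X" and "metrizable_space X"
    and "E \<union> F = topspace X" and "E \<inter> F = {}"
    and "zero_dimensional_space (subtopology X E)"
    and "zero_dimensional_space (subtopology X F)"
    and "absolutely_gdelta TYPE('b) (subtopology X E)"
    and "absolutely_fsigma_delta TYPE('c) (subtopology X F)"
  shows "\<exists>h. embedding_map X PQ_space h \<and> closedin PQ_space (h ` topspace X) \<and>
             E = {x \<in> topspace X. h x \<in> irrational_seqs} \<and>
             F = {x \<in> topspace X. h x \<in> rational_seqs}"
proof -
  define Y where "Y = irrational_seqs \<union> rational_seqs"
  have EX: "E \<subseteq> topspace X" and FX: "F \<subseteq> topspace X" using assms(3) by auto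
  have tE: "topspace (subtopology X E) = E" and tF: "topspace (subtopology X F) = F" using EX FX by auto
  \<comment> \<open>A first embedding into real sequences makes the metric lemmas applicable; the
    abstract \<open>X\<close> carries no type class structure.\<close>
  obtain e :: "'a \<Rightarrow> nat \<Rightarrow> real" where e: "embedding_map X euclidean e"
    using separable_metrizable_embedding[OF assms(1,2)] by metis
  have zd: "zero_dimensional_space (top_of_set (e ` S))"
    if "zero_dimensional_space (subtopology X S)" "S \<subseteq> topspace X" for S
  proof -
    have "topspace (subtopology X S) = S" using that(2) by auto
    then have "homeomorphic_map (subtopology X S) (top_of_set (e ` S)) e"
      using embedding_map_from_subtopology[OF e, of S] by (simp add: embedding_map_def)
    then show ?thesis using that(1) by (rule zero_dimensional_space_homeomorphic_map)
  qed
  define X0 where "X0 = e ` topspace X"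
  have inj: "inj_on e (topspace X)" using e unfolding embedding_map_def homeomorphic_map_def by auto
  have X0: "X0 - e ` E = e ` F" unfolding X0_def using inj assms(3,4) EX FX by (auto simp: inj_on_def)
  have "gdelta_in euclidean (e ` E)"
    using absolutely_gdelta_imp_gdelta_in[OF assms(7) metrizable_space_euclidean embedding_map_from_subtopology[OF e]] tE by simp
  then have "gdelta_in (top_of_set X0) (e ` E)"
    unfolding gdelta_in_subtopology using EX X0_def by (intro exI[of _ "e ` E"]) auto
  then obtain u where u: "embedding_map (top_of_set X0) euclidean u"
    "u ` (e ` E) \<subseteq> irrational_seqs" "u ` (e ` F) \<subseteq> rational_seqs"
    using embedding_into_PQ[of X0 "e ` E"] zd[OF assms(5) EX] zd[OF assms(6) FX] X0 by metis
  have "embedding_map X (top_of_set X0) e" using e X0_def by (simp add: embedding_map_in_subtopology)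
  then have k: "embedding_map X euclidean (u \<circ> e)" using u(1) embedding_map_compose by blast
  define k where "k = u \<circ> e"
  note k = k[folded k_def]
  have kE: "k ` E \<subseteq> irrational_seqs" and kF: "k ` F \<subseteq> rational_seqs" using u(2,3) by (auto simp: k_def)
  \<comment> \<open>Absoluteness is used once more, now for \<open>k\<close>: the image must be
    \<open>G_delta\<close> in all of \<open>Y\<close>, not only in the image of
    \<open>X\<close>.\<close>
  have "gdelta_in euclidean (k ` E)"
    using absolutely_gdelta_imp_gdelta_in[OF assms(7) metrizable_space_euclidean embedding_map_from_subtopology[OF k]] tE by simp
  then have kEg: "gdelta_in (top_of_set Y) (k ` E)"
    unfolding gdelta_in_subtopology using kE Y_def by (intro exI[of _ "k ` E"]) auto
  obtain \<S> where S: "countable \<S>" "\<And>S. S \<in> \<S> \<Longrightarrow> fsigma_in euclidean S" "k ` F = \<Inter>\<S>"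
    using absolutely_fsigma_delta_imp_Inter[OF assms(8) metrizable_space_euclidean embedding_map_from_subtopology[OF k]] tF by auto
  obtain \<Psi> where \<Psi>: "embedding_map (top_of_set Y) euclidean \<Psi>"
    "\<And>y. y \<in> Y \<Longrightarrow> \<Psi> y \<in> irrational_seqs \<longleftrightarrow> y \<in> k ` E" "\<And>y. y \<in> Y \<Longrightarrow> \<Psi> y \<in> rational_seqs \<longleftrightarrow> y \<in> k ` F"
    "closedin (top_of_set Y) (\<Psi> ` (k ` E \<union> k ` F))"
    by (rule closed_embedding_of_union[OF kE kEg[unfolded Y_def] kF S, folded Y_def]) (assumption | rule that)+
  have kY: "k x \<in> Y" if "x \<in> topspace X" for x using that kE kF assms(3) unfolding Y_def by blast
  have "embedding_map X (top_of_set Y) k" using k kY by (auto simp: embedding_map_in_subtopology)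
  then have \<Psi>k: "embedding_map X euclidean (\<Psi> \<circ> k)" using \<Psi>(1) embedding_map_compose by blast
  have injk: "inj_on k (topspace X)" using k unfolding embedding_map_def homeomorphic_map_def by auto
  have mem: "k x \<in> k ` S \<longleftrightarrow> x \<in> S" if "x \<in> topspace X" "S \<subseteq> topspace X" for x S
    using inj_on_image_mem_iff[OF injk that] .
  have hE: "E = {x \<in> topspace X. (\<Psi> \<circ> k) x \<in> irrational_seqs}"
    using \<Psi>(2)[OF kY] mem[OF _ EX] EX by auto
  have hF: "F = {x \<in> topspace X. (\<Psi> \<circ> k) x \<in> rational_seqs}"
    using \<Psi>(3)[OF kY] mem[OF _ FX] FX by auto
  \<comment> \<open>In general \<open>\<Psi>\<close> leaves \<open>Y\<close>: points of
    \<open>Y\<close> outside the image of \<open>X\<close> acquire coordinates of both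
    kinds.\<close>
  have "(\<Psi> \<circ> k) ` topspace X \<subseteq> Y" using hE hF assms(3) unfolding Y_def by auto
  then have "embedding_map X PQ_space (\<Psi> \<circ> k)"
    using \<Psi>k unfolding PQ_space_eq Y_def by (simp add: embedding_map_in_subtopology)
  moreover have "closedin PQ_space ((\<Psi> \<circ> k) ` topspace X)"
    using \<Psi>(4) assms(3) unfolding PQ_space_eq Y_def by (metis image_Un image_comp)
  ultimately show ?thesis using hE hF by blast
qed

end
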